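(* Let $n\ge 1$ be an integer, $\rho\in(0,1)$, $\beta>1/2$, and let $P_0$ be (the CDF of) a probability distribution on $\mathbb{R}$ that is absolutely continuous with respect to Lebesgue measure. Let $(y_{n+k})_{k\ge1}$ and $(P_k)_{k\ge 0}$ be the random sequences generated from $P_0$ by the Gaussian copula forward sampling scheme with parameters $(n,\rho,\beta)$, at a fixed feature value $x$. Then there exists a random probability distribution on $\mathbb{R}$, with (random) CDF $P_{\infty,x}$, such that for every $y\in\mathbb{R}$, almost surely, $$\lim_{N\to\infty}P_N(y)=P_{\infty,x}(y)=F_{\infty,x}(y),$$ where $F_{\infty,x}(y)=\lim_{N\to\infty}\frac1N\sum_{i=1}^N\mathbf{1}\{y_{n+i}\le y\}$ (in particular, this limit exists almost surely).
   Context: Gaussian copula forward sampling scheme with parameters $(n,\rho,\beta)$ started at $P_0$: $n$ is the size of an observed data set; the data and a feature value $x$ are fixed, so $P_0$ (the initial estimate of the posterior predictive distribution of a label given $x$ and the data) is deterministic; $x$ enters only through $P_0$. For $k=1,2,\dots$, conditionally on $y_{n+1},\dots,y_{n+k-1}$, draw $y_{n+k}\sim P_{k-1}$, and then set, for all $y\in\mathbb{R}$, $$P_k(y)=(1-\alpha_{n+k-1})P_{k-1}(y)+\alpha_{n+k-1}H_\rho\big(P_{k-1}(y),P_{k-1}(y_{n+k})\big),$$ where $P_k$ denotes a (random) CDF on $\mathbb{R}$, the learning rate is $\alpha_i=2^\beta(i+1)^{-\beta}$, and $$H_\rho(u,v)=\Phi\left(\frac{\Phi^{-1}(u)-\rho\,\Phi^{-1}(v)}{\sqrt{1-\rho^2}}\right),$$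 with $\Phi$ the standard normal CDF and conventions $\Phi^{-1}(0)=-\infty$, $\Phi^{-1}(1)=+\infty$, $\Phi(-\infty)=0$, $\Phi(+\infty)=1$ (the values $v\in\{0,1\}$ occur with probability zero and may be ignored). *)

theory Defs
  imports "HOL-Probability.Probability"
begin

text \<open>The standard normal CDF on the extended reals, so that it is a bijection onto
  \<open>{0..1}\<close> and \<open>inv std_normal_cdf\<close> satisfies the conventions
  \<open>\<Phi>\<^sup>-\<^sup>1(0) = -\<infinity>\<close> and \<open>\<Phi>\<^sup>-\<^sup>1(1) = \<infinity>\<close>. It is only ever inverted at values in
  \<open>{0..1}\<close>.\<close>

definition std_normal_cdf :: "ereal \<Rightarrow> real" where
  "std_normal_cdf z =
     (case z of ereal x \<Rightarrow> cdf std_normal_distribution x | PInfty \<Rightarrow> 1 | MInfty \<Rightarrow> 0)"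

text \<open>For \<open>0 < v < 1\<close> the extended real arithmetic below is unambiguous. For \<open>v = 0\<close> or
  \<open>v = 1\<close> it may involve \<open>\<infinity> - \<infinity>\<close>, whose library value is irrelevant: in the sampling scheme
  this happens with probability zero.\<close>

definition copula_H :: "real \<Rightarrow> real \<Rightarrow> real \<Rightarrow> real" where
  "copula_H \<rho> u v =
     std_normal_cdf
       ((inv std_normal_cdf u - ereal \<rho> * inv std_normal_cdf v) / ereal (sqrt (1 - \<rho>\<^sup>2)))"

definition learning_rate :: "real \<Rightarrow> nat \<Rightarrow> real" where
  "learning_rate \<beta> i = 2 powr \<beta> * real (i + 1) powr (- \<beta>)"

text \<open>The sigma-algebra on \<open>\<Omega>\<close> generated by \<open>y\<^sub>i\<close>, \<open>i \<in> I\<close>; it is trivial for \<open>I = {}\<close>.\<close>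

definition generated_by ::
    "'w measure \<Rightarrow> nat set \<Rightarrow> (nat \<Rightarrow> 'w \<Rightarrow> real) \<Rightarrow> 'w measure" where
  "generated_by M I y =
     vimage_algebra (space M) (\<lambda>\<omega>. \<lambda>i\<in>I. y i \<omega>) (PiM I (\<lambda>_. borel))"

text \<open>The real random variable \<open>X\<close> is drawn, conditionally on the sub-sigma-algebra \<open>G\<close>, from
  the distribution with (random) CDF \<open>F\<close>: a version of the conditional probability of
  \<open>X \<in> B\<close> given \<open>G\<close> is the mass that the distribution with CDF \<open>F \<omega>\<close> gives to \<open>B\<close>.\<close>

definition drawn_from_cdf ::
    "'w measure \<Rightarrow> 'w measure \<Rightarrow> ('w \<Rightarrow> real) \<Rightarrow> ('w \<Rightarrow> real \<Rightarrow> real) \<Rightarrow> bool" where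
  "drawn_from_cdf M G X F \<longleftrightarrow>
     X \<in> borel_measurable M \<and>
     (\<forall>B\<in>sets borel. AE \<omega> in M.
        real_cond_exp M G (indicator (X -` B \<inter> space M)) \<omega> = measure (interval_measure (F \<omega>)) B)"

text \<open>\<open>y i\<close> is only meaningful for \<open>i > n\<close>; the observed data and the feature value enter
  solely through the deterministic initial CDF \<open>P0\<close>.\<close>

definition copula_forward_sampling ::
    "'w measure \<Rightarrow> nat \<Rightarrow> real \<Rightarrow> real \<Rightarrow> (real \<Rightarrow> real) \<Rightarrow>
     (nat \<Rightarrow> 'w \<Rightarrow> real) \<Rightarrow> (nat \<Rightarrow> 'w \<Rightarrow> real \<Rightarrow> real) \<Rightarrow> bool" where
  "copula_forward_sampling M n \<rho> \<beta> P0 y P \<longleftrightarrow>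
     (\<forall>\<omega>\<in>space M. P 0 \<omega> = P0) \<and>
     (\<forall>k\<ge>1. drawn_from_cdf M (generated_by M {n+1..<n+k} y) (y (n+k)) (P (k-1))) \<and>
     (\<forall>k\<ge>1. \<forall>\<omega>\<in>space M. \<forall>t.
        P k \<omega> t =
          (1 - learning_rate \<beta> (n+k-1)) * P (k-1) \<omega> t
          + learning_rate \<beta> (n+k-1) * copula_H \<rho> (P (k-1) \<omega> t) (P (k-1) \<omega> (y (n+k) \<omega>)))"

definition empirical_cdf :: "nat \<Rightarrow> (nat \<Rightarrow> 'w \<Rightarrow> real) \<Rightarrow> nat \<Rightarrow> 'w \<Rightarrow> real \<Rightarrow> real" where
  "empirical_cdf n y N \<omega> t = (1 / real N) * (\<Sum>i=1..N. indicator {..t} (y (n+i) \<omega>))"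

definition limit_empirical_cdf :: "nat \<Rightarrow> (nat \<Rightarrow> 'w \<Rightarrow> real) \<Rightarrow> 'w \<Rightarrow> real \<Rightarrow> real" where
  "limit_empirical_cdf n y \<omega> t = lim (\<lambda>N. empirical_cdf n y N \<omega> t)"

end

theory Submission
  imports Defs
begin

text \<open>If a distribution has a continuous CDF \<open>F\<close> and \<open>Y\<close> is drawn from it, then \<open>F(Y)\<close> is uniform,
  and \<open>E H\<^sub>\<rho>(u, F(Y)) = u\<close> because \<open>\<rho> W + sqrt (1 - \<rho>\<^sup>2) W'\<close> is standard normal for independent
  standard normal \<open>W, W'\<close>. Hence \<open>P\<^sub>k(t)\<close> is a martingale for each \<open>t\<close>. Its increments are bounded by
  the learning rates, which are square summable since \<open>\<beta> > 1/2\<close>, so it converges almost surely by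
  Kolmogorov's maximal inequality. The same inequality applied to
  \<open>(1{y\<^sub>n\<^sub>+\<^sub>k \<le> t} - P\<^sub>k\<^sub>-\<^sub>1(t)) / k\<close>, with Kronecker's lemma and a Cesaro argument, gives the empirical
  limit. The limits at rational \<open>t\<close> are made right-continuous to obtain the random distribution; since
  \<open>E P\<^sub>k(t) = P\<^sub>0(t)\<close>, this changes the limit at a given \<open>t\<close> and loses mass at infinity only with
  probability zero.\<close>

section \<open>The Gaussian copula\<close>

text \<open>The hypothesis on each draw is weak in two ways: it speaks of one Borel set
  \<open>B\<close> at a time, with a null set depending on \<open>B\<close>, and of the raw
  \<open>P\<close>, whose values need not form a CDF for every \<open>\<omega>\<close>. The
  martingale computation needs expectations of functions that involve the past and the new draw at
  once, because the copula is evaluated at \<open>P k\<close> of a point drawn from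
  \<open>P k\<close> itself. Two devices bridge the gap: a disintegration formula that extends the
  conditioning to all nonnegative measurable functions of past and draw, and a regular version
  \<open>R\<close> of \<open>P\<close>. That \<open>P k = R k\<close> almost surely has to be shown
  by induction on \<open>k\<close>, since the law of the next draw is known to be that of
  \<open>R k\<close> only once this equality is known.

  Both limit statements then become instances of one theorem on series. In each, the term is a
  weight times the difference between a statistic of the new draw, with values in [0,1] and
  conditional mean \<open>R k \<omega> t\<close>, and that conditional mean. The weights are the
  learning rates in one case and \<open>1 / (k + 1)\<close> in the other, and both are square
  summable.\<close>

lemma (in real_distribution) absolutely_continuous_isCont_cdf:
  assumes "absolutely_continuous lborel M"
  shows "isCont (cdf M) x"
proof -
  have "{x} \<in> null_sets lborel" by (intro null_setsI) auto
  then have "{x} \<in> null_sets M"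
    using assms unfolding absolutely_continuous_def by blast
  then show ?thesis
    by (simp add: isCont_cdf measure_eq_0_null_sets)
qed

section \<open>The normal distribution function on the extended reals and its inverse\<close>

interpretation std_normal: real_distribution std_normal_distribution
  by (rule real_dist_normal_dist)

lemma isCont_cdf_std_normal: "isCont (cdf std_normal_distribution) x"
  by (rule std_normal.absolutely_continuous_isCont_cdf) (rule absolutely_continuousI_density, simp)

text \<open>Since the density is positive everywhere, an interval \<open>{x<..y}\<close> of zero
  mass would be Lebesgue null.\<close>

lemma cdf_std_normal_strict_mono: "strict_mono (cdf std_normal_distribution)"
proof (rule strict_monoI, rule ccontr)
  fix x y :: real assume xy: "x < y" "\<not> cdf std_normal_distribution x < cdf std_normal_distribution y"
  then have "measure std_normal_distribution {x<..y} = 0"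
    using std_normal.cdf_diff_eq[of x y] measure_nonneg[of std_normal_distribution "{x<..y}"] by linarith
  then have "emeasure std_normal_distribution {x<..y} = 0"
    by (simp add: std_normal.emeasure_eq_measure)
  then have "{x<..y} \<in> null_sets std_normal_distribution"
    by (simp add: null_sets_def)
  then have "AE z in lborel. z \<notin> {x<..y}"
    by (subst (asm) null_sets_density_iff)
      (auto elim!: eventually_mono simp: less_imp_neq[OF normal_density_pos, symmetric])
  then have "{x<..y} \<in> null_sets lborel"
    by (subst AE_iff_null_sets) auto
  with xy show False by (auto simp: null_sets_def)
qed

lemma std_normal_cdf_simps [simp]:
  "std_normal_cdf (ereal x) = cdf std_normal_distribution x"
  "std_normal_cdf \<infinity> = 1" "std_normal_cdf (-\<infinity>) = 0"
  by (simp_all add: std_normal_cdf_def)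

lemma cdf_std_normal_pos: "0 < cdf std_normal_distribution x"
  using strict_monoD[OF cdf_std_normal_strict_mono, of "x - 1" x] std_normal.cdf_nonneg[of "x - 1"] by simp

lemma cdf_std_normal_less_1: "cdf std_normal_distribution x < 1"
  using strict_monoD[OF cdf_std_normal_strict_mono, of x "x + 1"] std_normal.cdf_bounded_prob[of "x + 1"] by simp

lemma std_normal_cdf_strict_mono: "strict_mono std_normal_cdf"
proof (rule strict_monoI)
  fix x y :: ereal assume "x < y"
  then show "std_normal_cdf x < std_normal_cdf y"
    by (cases x; cases y)
      (auto simp: cdf_std_normal_pos cdf_std_normal_less_1 strict_monoD[OF cdf_std_normal_strict_mono])
qed

text \<open>The infinite points supply 0 and 1, the intermediate value theorem all values between.
  With strict monotonicity this makes \<open>inv std_normal_cdf\<close> a two-sided inverse on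
  \<open>{0..1}\<close>.\<close>

lemma range_std_normal_cdf: "range std_normal_cdf = {0..1}"
proof (intro equalityI subsetI)
  fix u assume "u \<in> range std_normal_cdf"
  then obtain z where "u = std_normal_cdf z" by auto
  then show "u \<in> {0..1}"
    by (cases z) (auto simp: std_normal.cdf_nonneg std_normal.cdf_bounded_prob)
next
  fix u :: real assume u: "u \<in> {0..1}"
  consider "u = 0" | "u = 1" | "0 < u" "u < 1" using u by force
  then show "u \<in> range std_normal_cdf"
  proof cases
    case 1 then show ?thesis by (metis rangeI std_normal_cdf_simps(3))
  next
    case 2 then show ?thesis by (metis rangeI std_normal_cdf_simps(2))
  next
    case 3
    have "eventually (\<lambda>x. cdf std_normal_distribution x < u) at_bot"
      using 3 std_normal.cdf_lim_at_bot order_tendstoD(2) by blast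
    then obtain a where a: "cdf std_normal_distribution a < u"
      by (meson eventually_at_bot_linorder order_refl)
    have "eventually (\<lambda>x. u < cdf std_normal_distribution x) at_top"
      using 3 std_normal.cdf_lim_at_top_prob order_tendstoD(1) by blast
    then obtain b where b: "u < cdf std_normal_distribution b"
      by (meson eventually_at_top_linorder order_refl)
    have "a \<le> b" using a b std_normal.cdf_nondecreasing[of b a] by (meson linear order.strict_trans not_le order.trans)
    then obtain x where "cdf std_normal_distribution x = u"
      using IVT[of "cdf std_normal_distribution" a u b] a b isCont_cdf_std_normal by auto
    then show ?thesis by (metis rangeI std_normal_cdf_simps(1))
  qed
qed

lemma inj_std_normal_cdf: "inj std_normal_cdf"
  by (rule strict_mono_imp_inj_on[OF std_normal_cdf_strict_mono])

lemma inv_std_normal_cdf [simp]: "inv std_normal_cdf (std_normal_cdf z) = z"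
  by (simp add: inj_std_normal_cdf)

lemma std_normal_cdf_inv: "u \<in> {0..1} \<Longrightarrow> std_normal_cdf (inv std_normal_cdf u) = u"
  by (rule f_inv_into_f) (simp add: range_std_normal_cdf)

lemma inv_std_normal_cdf_01 [simp]:
  "inv std_normal_cdf 0 = -\<infinity>" "inv std_normal_cdf 1 = \<infinity>"
  using inv_std_normal_cdf[of "-\<infinity>"] inv_std_normal_cdf[of \<infinity>] by simp_all

lemma mono_on_inv_std_normal_cdf: "mono_on {0..1} (inv std_normal_cdf)"
  by (rule mono_onI)
    (metis std_normal_cdf_inv std_normal_cdf_strict_mono strict_mono_less_eq)

lemma inv_std_normal_cdf_finite:
  assumes "0 < v" "v < 1"
  obtains z where "inv std_normal_cdf v = ereal z" "cdf std_normal_distribution z = v"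
proof -
  have v: "std_normal_cdf (inv std_normal_cdf v) = v" using assms std_normal_cdf_inv by simp
  show ?thesis
    using v assms that by (cases "inv std_normal_cdf v") auto
qed

text \<open>A monotone map with open image is continuous, and here the image is the whole extended
  line.\<close>

lemma continuous_on_inv_std_normal_cdf: "continuous_on {0..1} (inv std_normal_cdf)"
proof (rule continuous_onI_mono)
  have "inv std_normal_cdf ` {0..1} = UNIV"
    by (metis inj_std_normal_cdf inj_imp_surj_inv image_inv_f_f range_std_normal_cdf)
  then show "open (inv std_normal_cdf ` {0..1})" by simp
qed (use mono_on_inv_std_normal_cdf in \<open>auto simp: mono_on_def\<close>)

text \<open>The inverse of a continuous injection on the compact set \<open>{0..1}\<close> is
  continuous, which covers the infinite points without computing limits there.\<close>

lemma continuous_on_std_normal_cdf: "continuous_on UNIV std_normal_cdf"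
proof -
  have "inv std_normal_cdf ` {0..1} = UNIV"
    by (metis inj_std_normal_cdf image_inv_f_f range_std_normal_cdf)
  then show ?thesis
    using continuous_on_inv[OF continuous_on_inv_std_normal_cdf, of std_normal_cdf]
    by (simp add: std_normal_cdf_inv)
qed

text \<open>The clamping makes the function well behaved everywhere: at \<open>v = 0\<close> and \<open>v = 1\<close>, \<^const>\<open>copula_H\<close>
  may take junk values coming from \<open>\<infinity> - \<infinity>\<close>.\<close>

definition regular_copula :: "real \<Rightarrow> real \<Rightarrow> real \<Rightarrow> real" where
  "regular_copula \<rho> u v = copula_H \<rho> (max 0 (min 1 u)) (if 0 < v \<and> v < 1 then v else 1/2)"

lemma regular_copula_eq:
  "u \<in> {0..1} \<Longrightarrow> 0 < v \<Longrightarrow> v < 1 \<Longrightarrow> regular_copula \<rho> u v = copula_H \<rho> u v"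
  by (simp add: regular_copula_def)

lemma regular_copula_bounds: "regular_copula \<rho> u v \<in> {0..1}"
  unfolding regular_copula_def copula_H_def using range_std_normal_cdf by blast

text \<open>The replaced second argument lies strictly between 0 and 1, so its quantile is a real
  number and \<open>\<infinity> - \<infinity>\<close> cannot arise. Monotonicity, boundary values
  and continuity in \<open>u\<close> are all read off from this form.\<close>

lemma regular_copula_eq_affine:
  "\<exists>c. \<forall>u. regular_copula \<rho> u v =
    std_normal_cdf ((inv std_normal_cdf (max 0 (min 1 u)) - ereal c) / ereal (sqrt (1 - \<rho>\<^sup>2)))"
proof -
  obtain z where "inv std_normal_cdf (if 0 < v \<and> v < 1 then v else 1/2) = ereal z"
    by (rule inv_std_normal_cdf_finite[of "if 0 < v \<and> v < 1 then v else 1/2"]) auto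
  then show ?thesis
    by (intro exI[of _ "\<rho> * z"]) (simp add: regular_copula_def copula_H_def)
qed

lemma ereal_affine_mono:
  assumes "0 < s" "x \<le> y" shows "(x - ereal c) / ereal s \<le> (y - ereal c) / ereal s"
  using assms by (cases x; cases y) (auto simp: divide_right_mono)

lemma continuous_on_ereal_affine:
  assumes "0 < s" shows "continuous_on UNIV (\<lambda>x. (x - ereal c) / ereal s)"
proof (rule continuous_onI_mono)
  have "w \<in> range (\<lambda>x. (x - ereal c) / ereal s)" for w
  proof (cases w)
    case (real r)
    then have "w = (ereal (r * s + c) - ereal c) / ereal s" using assms by simp
    then show ?thesis by blast
  qed (use assms in \<open>auto intro: range_eqI[where x=\<infinity>] range_eqI[where x="-\<infinity>"]\<close>)
  then have "range (\<lambda>x. (x - ereal c) / ereal s) = UNIV" by blast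
  then show "open (range (\<lambda>x. (x - ereal c) / ereal s))" by simp
qed (use ereal_affine_mono assms in auto)

context
  fixes \<rho> :: real
  assumes \<rho>: "0 < \<rho>" "\<rho> < 1"
begin

lemma sqrt_one_minus_square_pos: "0 < sqrt (1 - \<rho>\<^sup>2)"
  using \<rho> by (simp add: power_less_one_iff)

lemma regular_copula_mono:
  assumes "u \<le> u'" shows "regular_copula \<rho> u v \<le> regular_copula \<rho> u' v"
proof -
  have "inv std_normal_cdf (max 0 (min 1 u)) \<le> inv std_normal_cdf (max 0 (min 1 u'))"
    using assms by (intro mono_onD[OF mono_on_inv_std_normal_cdf]) auto
  moreover obtain c where "\<And>u. regular_copula \<rho> u v =
    std_normal_cdf ((inv std_normal_cdf (max 0 (min 1 u)) - ereal c) / ereal (sqrt (1 - \<rho>\<^sup>2)))"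
    using regular_copula_eq_affine by blast
  ultimately show ?thesis
    using sqrt_one_minus_square_pos
    by (auto simp: std_normal_cdf_strict_mono strict_mono_less_eq intro: ereal_affine_mono)
qed

lemma regular_copula_0: "regular_copula \<rho> 0 v = 0"
  and regular_copula_1: "regular_copula \<rho> 1 v = 1"
proof -
  obtain c where "\<And>u. regular_copula \<rho> u v =
    std_normal_cdf ((inv std_normal_cdf (max 0 (min 1 u)) - ereal c) / ereal (sqrt (1 - \<rho>\<^sup>2)))"
    using regular_copula_eq_affine by blast
  then show "regular_copula \<rho> 0 v = 0" "regular_copula \<rho> 1 v = 1"
    using sqrt_one_minus_square_pos by simp_all
qed

lemma continuous_on_regular_copula: "continuous_on UNIV (\<lambda>u. regular_copula \<rho> u v)"
proof -
  obtain c where c: "\<And>u. regular_copula \<rho> u v =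
    std_normal_cdf ((inv std_normal_cdf (max 0 (min 1 u)) - ereal c) / ereal (sqrt (1 - \<rho>\<^sup>2)))"
    using regular_copula_eq_affine by blast
  show ?thesis unfolding c
    by (intro continuous_on_compose2[OF continuous_on_std_normal_cdf]
        continuous_on_compose2[OF continuous_on_ereal_affine]
        continuous_on_compose2[OF continuous_on_inv_std_normal_cdf] continuous_intros)
      (auto simp: sqrt_one_minus_square_pos[simplified])
qed

lemma regular_copula_measurable [measurable]:
  assumes [measurable]: "f \<in> borel_measurable M" "g \<in> borel_measurable M"
  shows "(\<lambda>x. regular_copula \<rho> (f x) (g x)) \<in> borel_measurable M"
proof -
  have [measurable]: "std_normal_cdf \<in> borel_measurable borel"
    by (rule borel_measurable_continuous_onI[OF continuous_on_std_normal_cdf])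
  \<comment> \<open>The clamped quantile is continuous on all of the reals and serves both
    arguments: clamping does not change the second one, which already lies strictly between 0 and
    1.\<close>
  define q where "q u = inv std_normal_cdf (max 0 (min 1 u))" for u
  have [measurable]: "q \<in> borel_measurable borel"
    unfolding q_def
    by (intro borel_measurable_continuous_onI continuous_on_compose2[OF continuous_on_inv_std_normal_cdf]
        continuous_intros) auto
  have "regular_copula \<rho> (f x) (g x) =
      std_normal_cdf ((q (f x) - ereal \<rho> * q (if 0 < g x \<and> g x < 1 then g x else 1/2))
        / ereal (sqrt (1 - \<rho>\<^sup>2)))" for x
    by (auto simp: regular_copula_def copula_H_def q_def)
  then show ?thesis by simp
qed

text \<open>The coordinates of the product space are independent, and the variances
  \<open>\<rho>\<^sup>2\<close> and \<open>1 - \<rho>\<^sup>2\<close> add up to 1.\<close>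

lemma std_normal_sum_distr:
  "distr (std_normal_distribution \<Otimes>\<^sub>M std_normal_distribution) borel
     (\<lambda>x. \<rho> * fst x + sqrt (1 - \<rho>\<^sup>2) * snd x) = std_normal_distribution"
proof -
  let ?N = "std_normal_distribution"
  interpret NN: pair_prob_space ?N ?N ..
  have dfst: "distr (?N \<Otimes>\<^sub>M ?N) lborel fst = ?N"
    using std_normal.distr_pair_fst[of ?N] by (simp cong: distr_cong)
  have dsnd: "distr (?N \<Otimes>\<^sub>M ?N) lborel snd = ?N"
    using dfst by (subst NN.distr_pair_swap) (simp add: distr_distr comp_def case_prod_beta)
  have f: "distributed (?N \<Otimes>\<^sub>M ?N) lborel fst (normal_density 0 1)"
    and s: "distributed (?N \<Otimes>\<^sub>M ?N) lborel snd (normal_density 0 1)"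
    unfolding distributed_def dfst dsnd by simp_all
  have ind: "NN.indep_var borel fst borel snd"
    unfolding NN.indep_var_distribution_eq
    using dfst dsnd
    by (simp cong: distr_cong) (rule distr_id2[symmetric], intro sets_pair_measure_cong, simp_all)
  have f': "distributed (?N \<Otimes>\<^sub>M ?N) lborel (\<lambda>x. 0 + \<rho> * fst x) (normal_density (0 + \<rho> * 0) (\<bar>\<rho>\<bar> * 1))"
    by (rule NN.normal_density_affine[OF f]) (use \<rho> in auto)
  have s': "distributed (?N \<Otimes>\<^sub>M ?N) lborel (\<lambda>x. 0 + sqrt (1 - \<rho>\<^sup>2) * snd x)
      (normal_density (0 + sqrt (1 - \<rho>\<^sup>2) * 0) (\<bar>sqrt (1 - \<rho>\<^sup>2)\<bar> * 1))"
    by (rule NN.normal_density_affine[OF s]) (use sqrt_one_minus_square_pos in auto)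
  have "NN.indep_var borel ((\<lambda>x. \<rho> * x) \<circ> fst) borel ((\<lambda>x. sqrt (1 - \<rho>\<^sup>2) * x) \<circ> snd)"
    by (rule NN.indep_var_compose[OF ind]) auto
  then have "distributed (?N \<Otimes>\<^sub>M ?N) lborel (\<lambda>x. \<rho> * fst x + sqrt (1 - \<rho>\<^sup>2) * snd x)
      (normal_density (0 + 0) (sqrt (\<rho>\<^sup>2 + (sqrt (1 - \<rho>\<^sup>2))\<^sup>2)))"
    using f' s' \<rho> sqrt_one_minus_square_pos
    by (intro NN.add_indep_normal) (auto simp: o_def)
  moreover have "(sqrt (1 - \<rho>\<^sup>2))\<^sup>2 = 1 - \<rho>\<^sup>2" using sqrt_one_minus_square_pos by simp
  ultimately show ?thesis
    unfolding distributed_def by (simp cong: distr_cong)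
qed

text \<open>With \<open>z\<close> the quantile of \<open>u\<close>, the integrand at
  \<open>w\<close> is the probability that
  \<open>\<rho> * w + sqrt (1 - \<rho>\<^sup>2) * W'\<close> is at most \<open>z\<close> for a
  standard normal \<open>W'\<close>. By Fubini the integral is the probability that a standard
  normal variable is at most \<open>z\<close>, which is \<open>u\<close>.\<close>

lemma nn_integral_regular_copula_std_normal:
  assumes "u \<in> {0..1}"
  shows "(\<integral>\<^sup>+w. ennreal (regular_copula \<rho> u (cdf std_normal_distribution w)) \<partial>std_normal_distribution) = ennreal u"
proof -
  let ?N = "std_normal_distribution"
  let ?s = "sqrt (1 - \<rho>\<^sup>2)"
  interpret NN: pair_prob_space ?N ?N ..
  consider "u = 0" | "u = 1" | "0 < u" "u < 1" using assms by force
  then show ?thesis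
  proof cases
    case 3
    then obtain z where z: "inv std_normal_cdf u = ereal z" "cdf ?N z = u"
      by (rule inv_std_normal_cdf_finite)
    have H: "regular_copula \<rho> u (cdf ?N w) = cdf ?N ((z - \<rho> * w) / ?s)" for w
    proof -
      have "inv std_normal_cdf (cdf ?N w) = ereal w"
        using inv_std_normal_cdf[of "ereal w"] by simp
      then show ?thesis using 3 assms cdf_std_normal_pos[of w] cdf_std_normal_less_1[of w] sqrt_one_minus_square_pos
        by (simp add: regular_copula_eq copula_H_def z)
    qed
    let ?A = "{x \<in> space (?N \<Otimes>\<^sub>M ?N). \<rho> * fst x + ?s * snd x \<le> z}"
    have A: "?A \<in> sets (?N \<Otimes>\<^sub>M ?N)" by measurable
    have "ennreal u = emeasure ?N {..z}"
      using z by (simp add: cdf_def std_normal.emeasure_eq_measure)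
    also have "\<dots> = emeasure (distr (?N \<Otimes>\<^sub>M ?N) borel (\<lambda>x. \<rho> * fst x + ?s * snd x)) {..z}"
      by (simp only: std_normal_sum_distr)
    also have "\<dots> = emeasure (?N \<Otimes>\<^sub>M ?N) ?A"
      by (subst emeasure_distr) (auto intro!: arg_cong2[where f=emeasure])
    also from A have "\<dots> = (\<integral>\<^sup>+w. emeasure ?N (Pair w -` ?A) \<partial>?N)"
      by (rule std_normal.emeasure_pair_measure_alt)
    also have "\<dots> = (\<integral>\<^sup>+w. ennreal (regular_copula \<rho> u (cdf ?N w)) \<partial>?N)"
    proof (rule nn_integral_cong)
      fix w
      have "Pair w -` ?A = {..(z - \<rho> * w) / ?s}"
        using sqrt_one_minus_square_pos by (auto simp: space_pair_measure field_simps)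
      then show "emeasure ?N (Pair w -` ?A) = ennreal (regular_copula \<rho> u (cdf ?N w))"
        unfolding H unfolding cdf_def2 by (simp add: std_normal.emeasure_eq_measure)
    qed
    finally show ?thesis ..
  qed (simp_all add: regular_copula_0 regular_copula_1 std_normal.emeasure_space_1[simplified])
qed

end

text \<open>By continuity and monotonicity the sublevel set is a half-line \<open>{..Sup S}\<close>,
  and the intermediate value theorem forces the CDF to equal \<open>s\<close> at its end. The strict
  bounds on \<open>s\<close> make the set nonempty and bounded above.\<close>

lemma (in real_distribution) measure_cdf_le:
  assumes cont: "\<And>x. isCont (cdf M) x" and s: "0 < s" "s < 1"
  shows "measure M {y. cdf M y \<le> s} = s"
proof -
  have "eventually (\<lambda>x. cdf M x < s) at_bot"
    using s cdf_lim_at_bot order_tendstoD(2) by blast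
  then obtain a where a: "cdf M a < s" by (meson eventually_at_bot_linorder order_refl)
  have "eventually (\<lambda>x. s < cdf M x) at_top"
    using s cdf_lim_at_top_prob order_tendstoD(1) by blast
  then obtain b where b: "s < cdf M b" by (meson eventually_at_top_linorder order_refl)
  define S where "S = {y. cdf M y \<le> s}"
  have "closed S" unfolding S_def
    by (intro closed_Collect_le continuous_intros) (simp add: continuous_at_imp_continuous_on cont)
  moreover have "S \<noteq> {}" using a unfolding S_def by (auto intro: less_imp_le)
  moreover have bdd: "bdd_above S"
    unfolding S_def using b cdf_nondecreasing by (intro bdd_aboveI[of _ b]) (smt (verit) mem_Collect_eq)
  ultimately have m: "Sup S \<in> S" by (rule closed_contains_Sup[rotated 2]) 
  have S: "S = {..Sup S}"
    using m cSup_upper[OF _ bdd] cdf_nondecreasing unfolding S_def by (auto intro: order_trans)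
  have "cdf M (Sup S) = s"
  proof (rule antisym)
    show "cdf M (Sup S) \<le> s" using m by (simp add: S_def)
    have "Sup S \<le> b" using m b cdf_nondecreasing[of b "Sup S"] unfolding S_def by force
    then obtain x where x: "cdf M x = s"
      using IVT[of "cdf M" "Sup S" s b] m b cont unfolding S_def by auto
    then have "x \<le> Sup S" using S unfolding S_def by auto
    then show "s \<le> cdf M (Sup S)" using cdf_nondecreasing x by metis
  qed
  then show ?thesis using S by (simp add: S_def cdf_def)
qed

text \<open>Both sides are the uniform law on [0,1], by the probability integral transform. Taking
  the normal distribution as the reference lets computations made for it transfer to every
  continuous law.\<close>

lemma (in real_distribution) distr_cdf_eq:
  assumes cont: "\<And>x. isCont (cdf M) x"
  shows "distr M borel (cdf M) = distr std_normal_distribution borel (cdf std_normal_distribution)"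
proof -
  have *: "cdf (distr N borel (cdf N)) s = (if s < 0 then 0 else if s < 1 then s else 1)" 
    if N: "real_distribution N" "\<And>x. isCont (cdf N) x" for N s
  proof -
    interpret N: real_distribution N by fact
    have [measurable]: "cdf N \<in> borel_measurable borel"
      by (intro borel_measurable_continuous_onI continuous_at_imp_continuous_on) (simp add: N)
    have eq: "cdf (distr N borel (cdf N)) s = measure N {y. cdf N y \<le> s}" for s
      unfolding cdf_def2[of "distr N borel (cdf N)"] by (simp add: measure_distr vimage_def)
    \<comment> \<open>\<open>measure_cdf_le\<close> does not cover level 0, so the mass there is
      squeezed below arbitrarily small positive levels; the cap \<open>1/2\<close> keeps them below
      1.\<close>
    have 0: "measure N {y. cdf N y \<le> 0} \<le> e" if "0 < e" for e
    proof -
      have "measure N {y. cdf N y \<le> 0} \<le> measure N {y. cdf N y \<le> min e (1/2)}"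
        using that by (intro N.finite_measure_mono) auto
      also have "\<dots> = min e (1/2)"
        using N that by (intro N.measure_cdf_le) auto
      finally show ?thesis by simp
    qed
    consider "s < 0" | "s = 0" | "0 < s" "s < 1" | "s \<ge> 1" by linarith
    then show ?thesis
    proof cases
      case 1
      then have "{y. cdf N y \<le> s} = {}" using N.cdf_nonneg by (auto simp: not_le intro: less_le_trans)
      then show ?thesis using 1 by (simp add: eq)
    next
      case 2
      then show ?thesis using field_le_epsilon[of "measure N {y. cdf N y \<le> 0}" 0] 0
        by (simp add: eq measure_le_0_iff)
    next
      case 3
      then show ?thesis using N.measure_cdf_le[OF N(2)] by (simp add: eq)
    next
      case 4
      then have "{y. cdf N y \<le> s} = UNIV" using N.cdf_bounded_prob by (auto intro: order_trans)
      then show ?thesis using 4 N.prob_space by (simp add: eq)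
    qed
  qed
  have [measurable]: "cdf M \<in> borel_measurable M" "cdf std_normal_distribution \<in> borel_measurable std_normal_distribution"
    by (auto intro!: measurable_finite_borel std_normal.measurable_finite_borel
        borel_measurable_continuous_onI continuous_at_imp_continuous_on cont isCont_cdf_std_normal)
  show ?thesis
    by (intro cdf_unique ext real_distribution_distr std_normal.real_distribution_distr)
      (simp_all add: * cont isCont_cdf_std_normal real_distribution_axioms std_normal.real_distribution_axioms)
qed

text \<open>The integrand depends on \<open>y\<close> only through \<open>cdf M y\<close>, whose law
  is the one from the normal case.\<close>

lemma (in real_distribution) nn_integral_regular_copula:
  assumes "0 < \<rho>" "\<rho> < 1" and cont: "\<And>x. isCont (cdf M) x" and "u \<in> {0..1}"
  shows "(\<integral>\<^sup>+y. ennreal (regular_copula \<rho> u (cdf M y)) \<partial>M) = ennreal u"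
proof -
  note [measurable] = regular_copula_measurable[OF assms(1,2)]
  have [measurable]: "cdf M \<in> borel_measurable M" "cdf std_normal_distribution \<in> borel_measurable std_normal_distribution"
    by (auto intro!: measurable_finite_borel std_normal.measurable_finite_borel
        borel_measurable_continuous_onI continuous_at_imp_continuous_on cont isCont_cdf_std_normal)
  have "(\<integral>\<^sup>+y. ennreal (regular_copula \<rho> u (cdf M y)) \<partial>M) =
      (\<integral>\<^sup>+v. ennreal (regular_copula \<rho> u v) \<partial>distr M borel (cdf M))"
    by (simp add: nn_integral_distr)
  also have "\<dots> = (\<integral>\<^sup>+w. ennreal (regular_copula \<rho> u (cdf std_normal_distribution w)) \<partial>std_normal_distribution)"
    by (simp add: distr_cdf_eq[OF cont] nn_integral_distr)
  finally show ?thesis using nn_integral_regular_copula_std_normal[OF assms(1,2,4)] by simp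
qed

text \<open>Only the law of \<open>cdf M\<close> matters, and the normal CDF stays strictly between
  0 and 1 at every real point.\<close>

lemma (in real_distribution) AE_cdf_in_01:
  assumes cont: "\<And>x. isCont (cdf M) x"
  shows "AE y in M. 0 < cdf M y \<and> cdf M y < 1"
proof -
  have [measurable]: "cdf M \<in> borel_measurable M" "cdf std_normal_distribution \<in> borel_measurable std_normal_distribution"
    by (auto intro!: measurable_finite_borel std_normal.measurable_finite_borel
        borel_measurable_continuous_onI continuous_at_imp_continuous_on cont isCont_cdf_std_normal)
  have "AE v in distr M borel (cdf M). 0 < v \<and> v < 1"
    unfolding distr_cdf_eq[OF cont]
    by (subst AE_distr_iff) (auto simp: cdf_std_normal_pos cdf_std_normal_less_1)
  then show ?thesis by (subst (asm) AE_distr_iff) auto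
qed

section \<open>Square-summable martingale differences\<close>

lemma cesaro_mean_tendsto:
  fixes x :: "nat \<Rightarrow> real"
  assumes "x \<longlonglongrightarrow> l"
  shows "(\<lambda>N. (\<Sum>i<N. x i) / real N) \<longlonglongrightarrow> l"
proof (rule LIMSEQ_I)
  fix e :: real assume e: "0 < e"
  from LIMSEQ_D[OF assms, of "e/2"] e obtain m where m: "\<And>i. i \<ge> m \<Longrightarrow> norm (x i - l) < e/2"
    by auto
  define C where "C = (\<Sum>i<m. \<bar>x i - l\<bar>)"
  have "C \<ge> 0" by (simp add: C_def sum_nonneg)
  obtain K where K: "real K > 2 * C / e" using reals_Archimedean2 by blast
  show "\<exists>no. \<forall>N\<ge>no. norm ((\<Sum>i<N. x i) / real N - l) < e"
  proof (intro exI allI impI)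
    fix N assume N: "N \<ge> max (max m K) 1"
    have "(\<Sum>i<N. x i) / real N - l = (\<Sum>i<N. x i - l) / real N"
      using N by (simp add: sum_subtractf field_simps)
    moreover have "\<bar>\<Sum>i<N. x i - l\<bar> \<le> C + real N * (e/2)"
    proof -
      have "\<bar>\<Sum>i<N. x i - l\<bar> \<le> (\<Sum>i<N. \<bar>x i - l\<bar>)" by (rule sum_abs)
      also have "\<dots> = C + (\<Sum>i=m..<N. \<bar>x i - l\<bar>)"
        using N by (simp add: C_def lessThan_atLeast0 sum.atLeastLessThan_concat)
      also have "(\<Sum>i=m..<N. \<bar>x i - l\<bar>) \<le> (\<Sum>i=m..<N. e/2)"
        using m by (intro sum_mono) (auto intro: less_imp_le)
      also have "\<dots> \<le> real N * (e/2)" using e by (simp add: mult_right_mono)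
      finally show ?thesis by simp
    qed
    moreover have "C < real N * (e/2)"
    proof -
      have "C < real K * (e/2)" using K e by (simp add: field_simps)
      also have "\<dots> \<le> real N * (e/2)" using N e by (intro mult_right_mono) auto
      finally show ?thesis .
    qed
    ultimately show "norm ((\<Sum>i<N. x i) / real N - l) < e"
      using N by (simp add: field_simps)
  qed
qed

text \<open>Summation by parts: with \<open>b\<close> the partial sums of the convergent series, the
  average of \<open>a\<close> equals \<open>b N\<close> minus the Cesaro mean of \<open>b\<close>,
  and both have the same limit.\<close>

lemma kronecker_lemma:
  fixes a :: "nat \<Rightarrow> real"
  assumes "summable (\<lambda>i. a i / real (Suc i))"
  shows "(\<lambda>N. (\<Sum>i<N. a i) / real N) \<longlonglongrightarrow> 0"
proof -
  define b where "b N = (\<Sum>i<N. a i / real (Suc i))" for N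
  from assms obtain l where l: "b \<longlonglongrightarrow> l"
    unfolding b_def summable_def sums_def by blast
  have *: "(\<Sum>i<N. a i) = real N * b N - (\<Sum>i<N. b i)" for N
  proof (induction N)
    case (Suc N)
    have "b (Suc N) = b N + a N / real (Suc N)" by (simp add: b_def)
    then have "real (Suc N) * b (Suc N) = real (Suc N) * b N + a N" by (simp add: distrib_left)
    then show ?case using Suc by (simp add: algebra_simps)
  qed (simp add: b_def)
  have "(\<lambda>N. b N - (\<Sum>i<N. b i) / real N) \<longlonglongrightarrow> l - l"
    by (intro tendsto_diff l cesaro_mean_tendsto)
  moreover have "eventually (\<lambda>N. b N - (\<Sum>i<N. b i) / real N = (\<Sum>i<N. a i) / real N) sequentially"
    using eventually_gt_at_top[of 0] by eventually_elim (simp add: * field_simps)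
  ultimately show ?thesis by (simp add: filterlim_cong)
qed

text \<open>Martingale differences with deterministic bounds. \<open>F i\<close> is the information
  available just before \<open>D i\<close> is revealed, and \<open>centered\<close> says that the
  conditional mean given \<open>F i\<close> is zero, tested on events.\<close>

locale square_summable_differences = prob_space M for M :: "'w measure" +
  fixes F :: "nat \<Rightarrow> 'w measure" and D :: "nat \<Rightarrow> 'w \<Rightarrow> real" and c :: "nat \<Rightarrow> real"
  assumes subalgebra_F: "\<And>i. subalgebra M (F i)"
    and F_mono: "\<And>i j. i \<le> j \<Longrightarrow> sets (F i) \<subseteq> sets (F j)"
    and adapted: "\<And>i. D i \<in> borel_measurable (F (Suc i))"
    and bounded: "\<And>i \<omega>. \<omega> \<in> space M \<Longrightarrow> \<bar>D i \<omega>\<bar> \<le> c i"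
    and summable: "summable (\<lambda>i. (c i)\<^sup>2)"
    and centered: "\<And>i A. A \<in> sets (F i) \<Longrightarrow> (\<integral>\<omega>. indicator A \<omega> * D i \<omega> \<partial>M) = 0"
begin

lemma measurable_D [measurable]: "D i \<in> borel_measurable M"
  using adapted measurable_from_subalg subalgebra_F by blast

lemma D_measurable_F: "i < j \<Longrightarrow> D i \<in> borel_measurable (F j)"
  using measurable_mono[of borel borel "F (Suc i)" "F j"] adapted[of i] F_mono[of "Suc i" j]
    subalgebra_F[of "Suc i"] subalgebra_F[of j]
  by (auto simp: subalgebra_def)

text \<open>\<open>centered\<close> identifies the conditional expectation of \<open>D i\<close>
  given \<open>F i\<close> as 0, and \<open>Z\<close>, being known at that time, factors out of it.
  The bound \<open>B\<close> secures integrability.\<close>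

lemma orthogonal:
  assumes Z: "Z \<in> borel_measurable (F i)" and B: "\<And>\<omega>. \<omega> \<in> space M \<Longrightarrow> \<bar>Z \<omega>\<bar> \<le> B"
  shows "(\<integral>\<omega>. Z \<omega> * D i \<omega> \<partial>M) = 0"
proof -
  interpret finite_measure_subalgebra M "F i"
    by unfold_locales (rule subalgebra_F)
  have [measurable]: "Z \<in> borel_measurable M"
    using Z measurable_from_subalg subalgebra_F by blast
  have D: "integrable M (D i)"
    by (rule integrable_const_bound[of _ "c i"]) (auto intro!: AE_I2 bounded)
  have "\<bar>Z \<omega> * D i \<omega>\<bar> \<le> B * c i" if "\<omega> \<in> space M" for \<omega>
    using B[OF that] bounded[OF that, of i] unfolding abs_mult by (intro mult_mono) auto
  then have ZD: "integrable M (\<lambda>\<omega>. Z \<omega> * D i \<omega>)"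
    by (intro integrable_const_bound[of _ "B * c i"]) (auto intro!: AE_I2)
  have "AE \<omega> in M. real_cond_exp M (F i) (D i) \<omega> = 0"
    using centered[of _ i] D
    by (intro real_cond_exp_charact) (auto simp: set_lebesgue_integral_def)
  then have "(\<integral>\<omega>. Z \<omega> * real_cond_exp M (F i) (D i) \<omega> \<partial>M) = (\<integral>\<omega>. 0 \<partial>M)"
    using Z by (intro integral_cong_AE) (auto)
  then show ?thesis
    using real_cond_exp_intg(2)[OF ZD Z] by simp
qed

definition "S m k \<omega> = (\<Sum>i=m..<m+k. D i \<omega>)"

text \<open>A sum that has reached \<open>\<epsilon>\<close> in absolute value stays there once it is stopped, so Chebyshev's
  inequality for the stopped sum controls the maximum of all partial sums.\<close>

primrec stopped :: "real \<Rightarrow> nat \<Rightarrow> nat \<Rightarrow> 'w \<Rightarrow> real" where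
  "stopped \<epsilon> m 0 \<omega> = 0"
| "stopped \<epsilon> m (Suc k) \<omega> = stopped \<epsilon> m k \<omega> +
     (if \<forall>j\<le>k. \<bar>S m j \<omega>\<bar> < \<epsilon> then D (m + k) \<omega> else 0)"

text \<open>The increment that first carries the sum across the threshold is still added, since only
  the earlier sums are tested; the stopped sum therefore freezes at a value of size at least
  \<open>\<epsilon>\<close>.\<close>

lemma stopped_eq:
  assumes "0 < \<epsilon>"
  shows "if \<forall>j\<le>k. \<bar>S m j \<omega>\<bar> < \<epsilon> then stopped \<epsilon> m k \<omega> = S m k \<omega> else \<epsilon> \<le> \<bar>stopped \<epsilon> m k \<omega>\<bar>"
proof (induction k)
  case 0
  then show ?case using assms by (simp add: S_def)
next
  case (Suc k)
  have "S m (Suc k) \<omega> = S m k \<omega> + D (m + k) \<omega>" by (simp add: S_def)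
  with Suc show ?case by (auto simp: le_Suc_eq split: if_splits)
qed

text \<open>Whether the sum is still running after \<open>k\<close> terms is decided by increments
  with index below \<open>m + k\<close>. The past alone therefore decides whether
  \<open>D (m + k)\<close> is added.\<close>

lemma stopped_measurable_F: "stopped \<epsilon> m k \<in> borel_measurable (F (m + k))"
  and live_measurable_F: "Measurable.pred (F (m + k)) (\<lambda>\<omega>. \<forall>j\<le>k. \<bar>S m j \<omega>\<bar> < \<epsilon>)"
proof -
  have [measurable]: "S m j \<in> borel_measurable (F (m + k))" if "j \<le> k" for j k
    unfolding S_def using that by (intro borel_measurable_sum D_measurable_F) auto
  have live: "Measurable.pred (F (m + k)) (\<lambda>\<omega>. \<forall>j\<le>k. \<bar>S m j \<omega>\<bar> < \<epsilon>)" for k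
    by measurable
  then show "Measurable.pred (F (m + k)) (\<lambda>\<omega>. \<forall>j\<le>k. \<bar>S m j \<omega>\<bar> < \<epsilon>)" .
  show "stopped \<epsilon> m k \<in> borel_measurable (F (m + k))"
  proof (induction k)
    case 0
    show ?case by (subst measurable_cong[where g="\<lambda>_. 0"]) auto
  next
    case (Suc k)
    have up: "f \<in> borel_measurable (F (m + Suc k))" if "f \<in> borel_measurable (F (m + k))" for f :: "'w \<Rightarrow> real"
      using that measurable_mono[of borel borel "F (m + k)" "F (m + Suc k)"] F_mono[of "m + k" "m + Suc k"]
        subalgebra_F[of "m + Suc k"] subalgebra_F[of "m + k"]
      by (auto simp: subalgebra_def)
    have "(\<lambda>\<omega>. indicator {\<omega> \<in> space (F (m + k)). \<forall>j\<le>k. \<bar>S m j \<omega>\<bar> < \<epsilon>} \<omega> :: real) \<in> borel_measurable (F (m + k))"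
      using live[of k] by (intro borel_measurable_indicator) (simp add: pred_def)
    from up[OF this] have [measurable]: "(\<lambda>\<omega>. indicator {\<omega> \<in> space (F (m + k)). \<forall>j\<le>k. \<bar>S m j \<omega>\<bar> < \<epsilon>} \<omega> :: real) \<in> borel_measurable (F (m + Suc k))" .
    note [measurable] = up[OF Suc] D_measurable_F[of "m + k" "m + Suc k"]
    have "(\<lambda>\<omega>. stopped \<epsilon> m k \<omega> + indicator {\<omega> \<in> space (F (m + k)). \<forall>j\<le>k. \<bar>S m j \<omega>\<bar> < \<epsilon>} \<omega> * D (m + k) \<omega>)
        \<in> borel_measurable (F (m + Suc k))"
      by measurable
    moreover have "space (F (m + Suc k)) = space (F (m + k))" 
      using subalgebra_F by (simp add: subalgebra_def)
    ultimately show ?case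
      by (subst measurable_cong) (auto simp: indicator_def)
  qed
qed

lemma stopped_bounded: "\<omega> \<in> space M \<Longrightarrow> \<bar>stopped \<epsilon> m k \<omega>\<bar> \<le> (\<Sum>i<k. c (m + i))"
proof (induction k)
  case (Suc k)
  have "0 \<le> c (m + k)" using bounded[OF Suc.prems, of "m + k"] by linarith
  then show ?case using Suc bounded[OF Suc.prems, of "m + k"] by auto
qed simp

lemma stopped_measurable [measurable]: "stopped \<epsilon> m k \<in> borel_measurable M"
  using stopped_measurable_F measurable_from_subalg subalgebra_F by blast

text \<open>When the square is expanded, the cross term pairs \<open>D (m + k)\<close> with a
  bounded function of the past and has mean zero, so each step contributes at most the square of its
  bound.\<close>

lemma expectation_stopped_square: "(\<integral>\<omega>. (stopped \<epsilon> m k \<omega>)\<^sup>2 \<partial>M) \<le> (\<Sum>i<k. (c (m + i))\<^sup>2)"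
proof (induction k)
  case 0 then show ?case by simp
next
  case (Suc k)
  define T where "T = stopped \<epsilon> m k"
  define L where "L = (indicator {\<omega> \<in> space M. \<forall>j\<le>k. \<bar>S m j \<omega>\<bar> < \<epsilon>} :: 'w \<Rightarrow> real)"
  have "space (F (m + k)) = space M"
    using subalgebra_F by (simp add: subalgebra_def)
  then have LF: "L \<in> borel_measurable (F (m + k))"
    unfolding L_def using live_measurable_F[where m=m and k=k and \<epsilon>=\<epsilon>]
    by (intro borel_measurable_indicator) (simp only: pred_def)
  then have [measurable]: "L \<in> borel_measurable M"
    using measurable_from_subalg subalgebra_F by blast
  have [measurable]: "T \<in> borel_measurable M" unfolding T_def by simp
  have TF: "T \<in> borel_measurable (F (m + k))" unfolding T_def by (rule stopped_measurable_F)
  define C where "C = (\<Sum>i<k. c (m + i))"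
  have T: "\<bar>T \<omega>\<bar> \<le> C" if "\<omega> \<in> space M" for \<omega>
    using stopped_bounded[OF that] by (simp add: T_def C_def)
  have L: "0 \<le> L \<omega>" "L \<omega> \<le> 1" for \<omega> by (auto simp: L_def indicator_def)
  have D2: "(D (m + k) \<omega>)\<^sup>2 \<le> (c (m + k))\<^sup>2" if "\<omega> \<in> space M" for \<omega>
    using bounded[OF that, of "m + k"] by (metis abs_ge_zero power2_abs power_mono)
  have TL: "\<bar>2 * T \<omega> * L \<omega>\<bar> \<le> 2 * C" if "\<omega> \<in> space M" for \<omega>
    using T[OF that] L[of \<omega>] mult_mono[of "\<bar>T \<omega>\<bar>" C "L \<omega>" 1] by (simp add: abs_mult)
  have i1: "integrable M (\<lambda>\<omega>. (T \<omega>)\<^sup>2)"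
  proof (intro integrable_const_bound[of _ "C\<^sup>2"] AE_I2)
    fix \<omega> assume "\<omega> \<in> space M"
    then have "\<bar>T \<omega>\<bar>\<^sup>2 \<le> C\<^sup>2" by (intro power_mono T) auto
    then show "norm ((T \<omega>)\<^sup>2) \<le> C\<^sup>2" by simp
  qed simp
  have i2: "integrable M (\<lambda>\<omega>. (2 * T \<omega> * L \<omega>) * D (m + k) \<omega>)"
  proof (intro integrable_const_bound[of _ "2 * C * c (m + k)"] AE_I2)
    fix \<omega> assume "\<omega> \<in> space M"
    then show "norm ((2 * T \<omega> * L \<omega>) * D (m + k) \<omega>) \<le> 2 * C * c (m + k)"
      unfolding real_norm_def abs_mult[of "2 * T \<omega> * L \<omega>" "D (m + k) \<omega>"]
      using TL[of \<omega>] bounded[of \<omega> "m + k"] by (intro mult_mono) linarith+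
  qed simp
  have i3: "integrable M (\<lambda>\<omega>. (c (m + k))\<^sup>2)" by simp
  \<comment> \<open>\<open>L\<close> takes only the values 0 and 1, so squaring it changes nothing;
    the quadratic term is at most \<open>(c (m + k))\<^sup>2\<close> whether or not the sum is still
    running.\<close>
  have "(stopped \<epsilon> m (Suc k) \<omega>)\<^sup>2 \<le> (T \<omega>)\<^sup>2 + (2 * T \<omega> * L \<omega>) * D (m + k) \<omega> + (c (m + k))\<^sup>2"
    if "\<omega> \<in> space M" for \<omega>
    using that D2[OF that] by (auto simp: L_def T_def power2_sum)
  then have "(\<integral>\<omega>. (stopped \<epsilon> m (Suc k) \<omega>)\<^sup>2 \<partial>M) \<le>
     (\<integral>\<omega>. (T \<omega>)\<^sup>2 + (2 * T \<omega> * L \<omega>) * D (m + k) \<omega> + (c (m + k))\<^sup>2 \<partial>M)"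
    using i1 i2 i3
    by (intro integral_mono' Bochner_Integration.integrable_add)
      (blast intro: order_trans[OF zero_le_power2])+
  also have "\<dots> = (\<integral>\<omega>. (T \<omega>)\<^sup>2 \<partial>M) + (\<integral>\<omega>. (2 * T \<omega> * L \<omega>) * D (m + k) \<omega> \<partial>M) + (c (m + k))\<^sup>2"
    using i1 i2 by (simp add: prob_space)
  also have "(\<integral>\<omega>. (2 * T \<omega> * L \<omega>) * D (m + k) \<omega> \<partial>M) = 0"
    using LF TF TL by (intro orthogonal[where B="2 * C"]) auto
  finally show ?case using Suc by (simp add: T_def)
qed

lemma S_measurable [measurable]: "S m k \<in> borel_measurable M"
  unfolding S_def by measurable

text \<open>For a finite horizon the bound is Chebyshev's inequality for the stopped sum. It is
  uniform in the horizon, and the events \<open>A k\<close> increase to the event in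
  question.\<close>

lemma maximal_inequality:
  assumes \<epsilon>: "0 < \<epsilon>"
  shows "prob {\<omega> \<in> space M. \<exists>k. \<epsilon> \<le> \<bar>S m k \<omega>\<bar>} \<le> (\<Sum>i. (c (m + i))\<^sup>2) / \<epsilon>\<^sup>2"
proof -
  have sm: "summable (\<lambda>i. (c (m + i))\<^sup>2)"
    using summable summable_iff_shift[of "\<lambda>i. (c i)\<^sup>2" m] by (simp add: add.commute)
  define A where "A k = {\<omega> \<in> space M. \<exists>j\<le>k. \<epsilon> \<le> \<bar>S m j \<omega>\<bar>}" for k
  have [measurable]: "A k \<in> sets M" for k unfolding A_def by measurable
  have "prob (A k) \<le> (\<Sum>i. (c (m + i))\<^sup>2) / \<epsilon>\<^sup>2" for k
  proof -
    let ?B = "(\<Sum>i<k. c (m + i))\<^sup>2"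
    have "integrable M (\<lambda>\<omega>. (stopped \<epsilon> m k \<omega>)\<^sup>2)"
    proof (intro integrable_const_bound[of _ ?B] AE_I2)
      fix \<omega> assume "\<omega> \<in> space M"
      then have "\<bar>stopped \<epsilon> m k \<omega>\<bar>\<^sup>2 \<le> ?B" by (intro power_mono stopped_bounded) auto
      then show "norm ((stopped \<epsilon> m k \<omega>)\<^sup>2) \<le> ?B" by simp
    qed simp
    then have "prob {\<omega> \<in> space M. \<epsilon>\<^sup>2 \<le> (stopped \<epsilon> m k \<omega>)\<^sup>2} \<le> (\<integral>\<omega>. (stopped \<epsilon> m k \<omega>)\<^sup>2 \<partial>M) / \<epsilon>\<^sup>2"
      using \<epsilon> by (intro integral_Markov_inequality_measure[where A="{}"]) auto
    also have "\<dots> \<le> (\<Sum>i<k. (c (m + i))\<^sup>2) / \<epsilon>\<^sup>2"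
      by (intro divide_right_mono expectation_stopped_square) auto
    also have "\<dots> \<le> (\<Sum>i. (c (m + i))\<^sup>2) / \<epsilon>\<^sup>2"
      by (intro divide_right_mono sum_le_suminf sm) auto
    finally have *: "prob {\<omega> \<in> space M. \<epsilon>\<^sup>2 \<le> (stopped \<epsilon> m k \<omega>)\<^sup>2} \<le> (\<Sum>i. (c (m + i))\<^sup>2) / \<epsilon>\<^sup>2" .
    have "A k \<subseteq> {\<omega> \<in> space M. \<epsilon>\<^sup>2 \<le> (stopped \<epsilon> m k \<omega>)\<^sup>2}"
    proof
      fix \<omega> assume \<omega>: "\<omega> \<in> A k"
      then have "\<epsilon> \<le> \<bar>stopped \<epsilon> m k \<omega>\<bar>"
        using stopped_eq[OF \<epsilon>, of k m \<omega>] by (auto simp: A_def not_less split: if_splits)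
      then show "\<omega> \<in> {\<omega> \<in> space M. \<epsilon>\<^sup>2 \<le> (stopped \<epsilon> m k \<omega>)\<^sup>2}"
        using \<omega> \<epsilon> by (auto simp: A_def abs_le_square_iff[symmetric])
    qed
    then have "prob (A k) \<le> prob {\<omega> \<in> space M. \<epsilon>\<^sup>2 \<le> (stopped \<epsilon> m k \<omega>)\<^sup>2}"
      by (intro finite_measure_mono) auto
    with * show ?thesis by simp
  qed
  moreover have "(\<lambda>k. prob (A k)) \<longlonglongrightarrow> prob (\<Union>k. A k)"
    by (intro finite_Lim_measure_incseq) (auto simp: incseq_def A_def intro: order_trans)
  ultimately have "prob (\<Union>k. A k) \<le> (\<Sum>i. (c (m + i))\<^sup>2) / \<epsilon>\<^sup>2"
    by (intro LIMSEQ_le_const2) auto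
  moreover have "(\<Union>k. A k) = {\<omega> \<in> space M. \<exists>k. \<epsilon> \<le> \<bar>S m k \<omega>\<bar>}"
    by (auto simp: A_def)
  ultimately show ?thesis by simp
qed

text \<open>For a fixed precision, the event that every starting index \<open>m\<close> is followed
  by a large block sum has probability below every tail of the series of
  \<open>(c i)\<^sup>2\<close>, hence 0. Countably many precisions give the Cauchy
  criterion.\<close>

theorem AE_summable: "AE \<omega> in M. summable (\<lambda>i. D i \<omega>)"
proof -
  have "AE \<omega> in M. \<exists>m. \<forall>k. \<bar>S m k \<omega>\<bar> < 1 / real (Suc p)" for p
  proof -
    define \<epsilon> where "\<epsilon> = 1 / real (Suc p)"
    have \<epsilon>: "0 < \<epsilon>" by (simp add: \<epsilon>_def)
    define N where "N m = {\<omega> \<in> space M. \<exists>k. \<epsilon> \<le> \<bar>S m k \<omega>\<bar>}" for m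
    have [measurable]: "N m \<in> sets M" for m unfolding N_def by measurable
    have tail: "(\<lambda>m. (\<Sum>i. (c (m + i))\<^sup>2) / \<epsilon>\<^sup>2) \<longlonglongrightarrow> 0 / \<epsilon>\<^sup>2"
      using suminf_exist_split2[OF summable] \<epsilon> by (intro tendsto_divide) (auto simp: add.commute)
    have "prob (\<Inter>m. N m) \<le> (\<Sum>i. (c (m + i))\<^sup>2) / \<epsilon>\<^sup>2" for m
    proof -
      have "prob (\<Inter>m. N m) \<le> prob (N m)" by (intro finite_measure_mono) auto
      also have "\<dots> \<le> (\<Sum>i. (c (m + i))\<^sup>2) / \<epsilon>\<^sup>2" unfolding N_def by (rule maximal_inequality[OF \<epsilon>])
      finally show ?thesis .
    qed
    then have "prob (\<Inter>m. N m) \<le> 0"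
      using LIMSEQ_le_const[OF tail, of "prob (\<Inter>m. N m)"] by auto
    then have "(\<Inter>m. N m) \<in> null_sets M"
      by (simp add: null_sets_def emeasure_eq_measure measure_le_0_iff)
    then have "AE \<omega> in M. \<omega> \<notin> (\<Inter>m. N m)" by (rule AE_not_in)
    then show ?thesis by (auto elim!: AE_mp simp: N_def not_le \<epsilon>_def)
  qed
  then have "AE \<omega> in M. \<forall>p. \<exists>m. \<forall>k. \<bar>S m k \<omega>\<bar> < 1 / real (Suc p)"
    by (subst AE_all_countable) auto
  then show ?thesis
  proof eventually_elim
    fix \<omega> assume *: "\<forall>p. \<exists>m. \<forall>k. \<bar>S m k \<omega>\<bar> < 1 / real (Suc p)"
    show "summable (\<lambda>i. D i \<omega>)"
      unfolding summable_Cauchy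
    proof (intro allI impI)
      fix e :: real assume "0 < e"
      then obtain p where p: "1 / real (Suc p) < e / 2"
        using nat_approx_posE[of "e/2"] by auto
      from * obtain m where m: "\<And>k. \<bar>S m k \<omega>\<bar> < 1 / real (Suc p)" by blast
      have "norm (\<Sum>i=a..<b. D i \<omega>) < e" if "a \<ge> m" for a b
      proof (cases "a \<le> b")
        case True
        have "(\<Sum>i=a..<b. D i \<omega>) = S m (b - m) \<omega> - S m (a - m) \<omega>"
          using True that sum.atLeastLessThan_concat[of m a b "\<lambda>i. D i \<omega>"] by (simp add: S_def)
        then show ?thesis
          using m[of "b - m"] m[of "a - m"] p unfolding real_norm_def by linarith
      qed (use \<open>0 < e\<close> in simp)
      then show "\<exists>N. \<forall>m\<ge>N. \<forall>n. norm (\<Sum>i=m..<n. D i \<omega>) < e" by blast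
    qed
  qed
qed

end

section \<open>Limits of random distribution functions\<close>

text \<open>Monotonicity gives a pointwise limit; by dominated convergence it has mean 0, and being
  nonnegative it vanishes almost surely.\<close>

lemma (in prob_space) AE_tendsto_0_of_decseq:
  fixes Z :: "nat \<Rightarrow> 'a \<Rightarrow> real"
  assumes [measurable]: "\<And>j. Z j \<in> borel_measurable M"
    and dec: "AE \<omega> in M. decseq (\<lambda>j. Z j \<omega>)"
    and bounds: "\<And>j. AE \<omega> in M. Z j \<omega> \<in> {0..1}"
    and lim: "(\<lambda>j. \<integral>\<omega>. Z j \<omega> \<partial>M) \<longlonglongrightarrow> 0"
  shows "AE \<omega> in M. (\<lambda>j. Z j \<omega>) \<longlonglongrightarrow> 0"
proof -
  define U where "U \<omega> = lim (\<lambda>j. Z j \<omega>)" for \<omega>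
  have [measurable]: "U \<in> borel_measurable M" unfolding U_def by measurable
  have bounds': "AE \<omega> in M. \<forall>j. Z j \<omega> \<in> {0..1}"
    using bounds by (subst AE_all_countable) auto
  with dec have conv: "AE \<omega> in M. (\<lambda>j. Z j \<omega>) \<longlonglongrightarrow> U \<omega>"
  proof eventually_elim
    case (elim \<omega>)
    then have "convergent (\<lambda>j. Z j \<omega>)"
      using decseq_convergent[of "\<lambda>j. Z j \<omega>" 0] by (metis atLeastAtMost_iff convergent_def)
    then show ?case by (simp add: U_def convergent_LIMSEQ_iff)
  qed
  have "(\<lambda>j. \<integral>\<omega>. Z j \<omega> \<partial>M) \<longlonglongrightarrow> (\<integral>\<omega>. U \<omega> \<partial>M)"
  proof (rule integral_dominated_convergence[where w="\<lambda>_. 1"])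
    show "AE \<omega> in M. norm (Z j \<omega>) \<le> 1" for j using bounds[of j] by eventually_elim auto
  qed (use conv in auto)
  then have 0: "(\<integral>\<omega>. U \<omega> \<partial>M) = 0" using lim LIMSEQ_unique by blast
  have U: "AE \<omega> in M. U \<omega> \<in> {0..1}"
    using conv bounds'
  proof eventually_elim
    case (elim \<omega>)
    then show ?case using LIMSEQ_le_const LIMSEQ_le_const2 by (metis atLeastAtMost_iff)
  qed
  have "integrable M U"
  proof (rule integrable_const_bound[of _ 1])
    show "AE \<omega> in M. norm (U \<omega>) \<le> 1" using U by eventually_elim auto
  qed simp
  then have "AE \<omega> in M. U \<omega> = 0"
    using U 0 by (subst (asm) integral_nonneg_eq_0_iff_AE) (auto elim: eventually_mono)
  with conv show ?thesis by eventually_elim simp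
qed

text \<open>The half-lines \<open>{..t}\<close> form an intersection-stable generator of the Borel
  sets.\<close>

lemma measurable_prob_algebra_cdf:
  assumes "\<And>\<omega>. \<omega> \<in> space M \<Longrightarrow> real_distribution (Q \<omega>)"
    and "\<And>t. (\<lambda>\<omega>. cdf (Q \<omega>) t) \<in> borel_measurable M"
  shows "Q \<in> measurable M (prob_algebra borel)"
proof (rule measurable_prob_algebra_generated[where \<Omega>=UNIV and G="range atMost"])
  show "sets borel = sigma_sets UNIV (range atMost :: real set set)"
    by (subst borel_eq_atMost) (simp add: image_def)
  show "(\<lambda>\<omega>. emeasure (Q \<omega>) A) \<in> borel_measurable M" if A: "A \<in> range atMost" for A
  proof -
    obtain t where t: "A = {..t}" using A by auto
    have "emeasure (Q \<omega>) A = ennreal (cdf (Q \<omega>) t)" if "\<omega> \<in> space M" for \<omega>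
    proof -
      interpret Q: real_distribution "Q \<omega>" by (rule assms(1)[OF that])
      show ?thesis by (simp add: t Q.emeasure_eq_measure cdf_def2)
    qed
    with assms(2) show ?thesis by (subst measurable_cong) auto
  qed
  fix \<omega> assume \<omega>: "\<omega> \<in> space M"
  then interpret Q: real_distribution "Q \<omega>" by (rule assms(1))
  show "prob_space (Q \<omega>)" "sets (Q \<omega>) = sets borel" by (unfold_locales, simp)
qed (auto simp: Int_stable_def)

text \<open>The null set in \<open>conv\<close> depends on \<open>t\<close>, and uncountably many
  null sets cannot be discarded together. Joint convergence is therefore used only at rational
  points, and every other comparison is made at one fixed \<open>t\<close>.\<close>

lemma (in prob_space) random_cdf_limit:
  fixes X :: "nat \<Rightarrow> 'a \<Rightarrow> real \<Rightarrow> real"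
  assumes "real_distribution \<mu>"
    and meas [measurable]: "\<And>k t. (\<lambda>\<omega>. X k \<omega> t) \<in> borel_measurable M"
    and mono: "\<And>k \<omega> s t. \<omega> \<in> space M \<Longrightarrow> s \<le> t \<Longrightarrow> X k \<omega> s \<le> X k \<omega> t"
    and bounds: "\<And>k \<omega> t. \<omega> \<in> space M \<Longrightarrow> X k \<omega> t \<in> {0..1}"
    and mean: "\<And>k t. (\<integral>\<omega>. X k \<omega> t \<partial>M) = cdf \<mu> t"
    and conv: "\<And>t. AE \<omega> in M. convergent (\<lambda>k. X k \<omega> t)"
  shows "\<exists>Q \<in> measurable M (prob_algebra borel).
    \<forall>t. AE \<omega> in M. (\<lambda>k. X k \<omega> t) \<longlonglongrightarrow> cdf (Q \<omega>) t"
proof -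
  interpret \<mu>: real_distribution \<mu> by fact
  \<comment> \<open>For a divergent sequence \<open>lim\<close> is unspecified; clamping keeps
    \<open>L\<close> in [0,1] for every \<open>\<omega>\<close>, so its infima and integrals always
    make sense.\<close>
  define L where "L \<omega> t = max 0 (min 1 (lim (\<lambda>k. X k \<omega> t)))" for \<omega> t
  have L01: "0 \<le> L \<omega> t" "L \<omega> t \<le> 1" for \<omega> t by (auto simp: L_def)
  have [measurable]: "(\<lambda>\<omega>. L \<omega> t) \<in> borel_measurable M" for t
    unfolding L_def by measurable
  have L: "(\<lambda>k. X k \<omega> t) \<longlonglongrightarrow> L \<omega> t"
    if "\<omega> \<in> space M" "convergent (\<lambda>k. X k \<omega> t)" for \<omega> t
  proof -
    have *: "(\<lambda>k. X k \<omega> t) \<longlonglongrightarrow> lim (\<lambda>k. X k \<omega> t)"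
      using that by (simp add: convergent_LIMSEQ_iff)
    moreover have "0 \<le> lim (\<lambda>k. X k \<omega> t)" "lim (\<lambda>k. X k \<omega> t) \<le> 1"
      using bounds[OF that(1), of _ t] by (auto intro: LIMSEQ_le_const[OF *] LIMSEQ_le_const2[OF *])
    ultimately show ?thesis by (simp add: L_def)
  qed
  have L_int: "integrable M (\<lambda>\<omega>. L \<omega> t)" for t
    by (rule integrable_const_bound[of _ 1]) (auto simp: L01)
  have mean_L: "(\<integral>\<omega>. L \<omega> t \<partial>M) = cdf \<mu> t" for t
  proof -
    have "(\<lambda>k. \<integral>\<omega>. X k \<omega> t \<partial>M) \<longlonglongrightarrow> (\<integral>\<omega>. L \<omega> t \<partial>M)"
    proof (rule integral_dominated_convergence[where w="\<lambda>_. 1"])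
      show "AE \<omega> in M. (\<lambda>k. X k \<omega> t) \<longlonglongrightarrow> L \<omega> t"
        using conv[of t] AE_space by eventually_elim (rule L)
      show "AE \<omega> in M. norm (X k \<omega> t) \<le> 1" for k
        using bounds by (intro AE_I2) auto
    qed auto
    then show ?thesis by (simp add: mean LIMSEQ_const_iff)
  qed
  have L_mono: "L \<omega> s \<le> L \<omega> t"
    if "\<omega> \<in> space M" "convergent (\<lambda>k. X k \<omega> s)" "convergent (\<lambda>k. X k \<omega> t)" "s \<le> t" for \<omega> s t
    using LIMSEQ_le[OF L[OF that(1,2)] L[OF that(1,3)]] mono[OF that(1,4)] by blast
  have convQ: "AE \<omega> in M. \<forall>q\<in>\<rat>. convergent (\<lambda>k. X k \<omega> q)"
    using conv countable_rat by (subst AE_ball_countable) auto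
  \<comment> \<open>Integers are rational, so monotonicity holds along them almost surely, while the
    mean \<open>1 - cdf \<mu> j\<close> tends to 0.\<close>
  have top: "AE \<omega> in M. (\<lambda>j. 1 - L \<omega> (real j)) \<longlonglongrightarrow> 0"
  proof (rule AE_tendsto_0_of_decseq)
    show "AE \<omega> in M. decseq (\<lambda>j. 1 - L \<omega> (real j))"
      using convQ AE_space by eventually_elim (auto simp: decseq_def intro: L_mono)
    show "(\<lambda>j. \<integral>\<omega>. 1 - L \<omega> (real j) \<partial>M) \<longlonglongrightarrow> 0"
      using tendsto_diff[OF tendsto_const[of 1] \<mu>.cdf_lim_infty_prob] L_int
      by (simp add: mean_L prob_space)
  qed (auto simp: L01)
  have bot: "AE \<omega> in M. (\<lambda>j. L \<omega> (- real j)) \<longlonglongrightarrow> 0"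
  proof (rule AE_tendsto_0_of_decseq)
    show "AE \<omega> in M. decseq (\<lambda>j. L \<omega> (- real j))"
      using convQ AE_space by eventually_elim (auto simp: decseq_def intro: L_mono)
    show "(\<lambda>j. \<integral>\<omega>. L \<omega> (- real j) \<partial>M) \<longlonglongrightarrow> 0"
      using \<mu>.cdf_lim_neg_infty by (simp add: mean_L)
  qed (auto simp: L01)
  obtain N where N: "N \<in> null_sets M" and good: "\<And>\<omega>. \<omega> \<in> space M - N \<Longrightarrow>
      (\<forall>q\<in>\<rat>. convergent (\<lambda>k. X k \<omega> q)) \<and> (\<lambda>j. 1 - L \<omega> (real j)) \<longlonglongrightarrow> 0
      \<and> (\<lambda>j. L \<omega> (- real j)) \<longlonglongrightarrow> 0"
    using AE_conjI[OF convQ AE_conjI[OF top bot]] by (rule AE_E3) blast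
  \<comment> \<open>The strict inequality \<open>t < q\<close> yields right continuity: a small
    value of \<open>L\<close> at \<open>q\<close> bounds \<open>G\<close> at every point to the left
    of \<open>q\<close>.\<close>
  define G where "G \<omega> t = (INF q\<in>{q\<in>\<rat>. t < q}. L \<omega> q)" for \<omega> t
  have ne: "{q\<in>\<rat>. t < q} \<noteq> {}" for t :: real
    using Rats_dense_in_real[of t "t + 1"] by auto
  have bdd: "bdd_below (L \<omega> ` A)" for \<omega> A
    using L01 by (intro bdd_belowI2[of _ 0]) auto
  have G_le: "G \<omega> t \<le> L \<omega> q" if "q \<in> \<rat>" "t < q" for \<omega> t q
    unfolding G_def using that by (intro cINF_lower bdd) auto
  have G_greatest: "c \<le> G \<omega> t" if "\<And>q. q \<in> \<rat> \<Longrightarrow> t < q \<Longrightarrow> c \<le> L \<omega> q" for c \<omega> t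
    unfolding G_def using that by (intro cINF_greatest ne) auto
  have G01: "0 \<le> G \<omega> t" "G \<omega> t \<le> 1" for \<omega> t
  proof -
    show "0 \<le> G \<omega> t" by (intro G_greatest L01)
    obtain q where "q \<in> \<rat>" "t < q" using ne by blast
    then show "G \<omega> t \<le> 1" using G_le[of q t \<omega>] L01(2)[of \<omega> q] by simp
  qed
  have [measurable]: "(\<lambda>\<omega>. G \<omega> t) \<in> borel_measurable M" for t
    unfolding G_def using countable_rat ne bdd
    by (intro borel_measurable_cINF) (auto intro: countable_subset[of _ \<rat>])
  have G_mono: "G \<omega> s \<le> G \<omega> t" if "s \<le> t" for \<omega> s t
    using that by (intro G_greatest G_le) auto
  have G_right_cont: "continuous (at_right a) (G \<omega>)" for a \<omega>
    unfolding continuous_within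
  proof (rule order_tendstoI)
    fix l assume "l < G \<omega> a"
    then show "\<forall>\<^sub>F x in at_right a. l < G \<omega> x"
      using G_mono[of a _ \<omega>]
      by (intro eventually_at_right_less[THEN eventually_mono]) (auto intro: less_le_trans)
  next
    fix u assume "G \<omega> a < u"
    then obtain q where q: "q \<in> \<rat>" "a < q" "L \<omega> q < u"
      unfolding G_def by (subst (asm) cINF_less_iff) (use ne bdd in auto)
    have "\<forall>\<^sub>F x in at_right a. x < q"
      using q(2) eventually_at_right_real[OF q(2)] by (auto elim: eventually_mono)
    then show "\<forall>\<^sub>F x in at_right a. G \<omega> x < u"
      by eventually_elim (use G_le q in \<open>auto intro: le_less_trans\<close>)
  qed
  have G_bot: "(G \<omega> \<longlongrightarrow> 0) at_bot" if "\<omega> \<in> space M - N" for \<omega>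
  proof (rule order_tendstoI)
    fix u :: real assume "0 < u"
    then have "\<forall>\<^sub>F j in sequentially. L \<omega> (- real j) < u"
      using good[OF that] order_tendstoD(2) by blast
    then obtain j where "L \<omega> (- real j) < u" by (meson eventually_happens sequentially_bot)
    then have "G \<omega> t < u" if "t < - real j" for t
      using G_le[of "- real j" t \<omega>] that by auto
    then show "\<forall>\<^sub>F t in at_bot. G \<omega> t < u" using eventually_at_bot_dense by blast
  qed (auto intro: always_eventually less_le_trans[OF _ G01(1)])
  have G_top: "(G \<omega> \<longlongrightarrow> 1) at_top" if \<omega>: "\<omega> \<in> space M - N" for \<omega>
  proof (rule order_tendstoI)
    fix l :: real assume "l < 1"
    then have "\<forall>\<^sub>F j in sequentially. 1 - L \<omega> (real j) < 1 - l"
      using good[OF that] order_tendstoD(2)[of "\<lambda>j. 1 - L \<omega> (real j)" 0 sequentially "1 - l"] by simp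
    then obtain j where j: "l < L \<omega> (real j)" by (auto simp: eventually_sequentially)
    have "l < G \<omega> t" if "real j < t" for t
    proof -
      have "L \<omega> (real j) \<le> G \<omega> t"
        using \<omega> good[OF \<omega>] that by (intro G_greatest L_mono) auto
      with j show ?thesis by simp
    qed
    then show "\<forall>\<^sub>F t in at_top. l < G \<omega> t" using eventually_at_top_dense by blast
  qed (auto intro: always_eventually le_less_trans[OF G01(2)])
  \<comment> \<open>The fallback \<open>cdf \<mu>\<close> on the null set makes
    \<open>Q \<omega>\<close> a probability distribution for every \<open>\<omega>\<close>, as
    \<open>prob_algebra\<close> demands.\<close>
  define K where "K \<omega> = (if \<omega> \<in> N then cdf \<mu> else G \<omega>)" for \<omega>
  have K: "K \<omega> s \<le> K \<omega> t" "continuous (at_right a) (K \<omega>)" "(K \<omega> \<longlongrightarrow> 0) at_bot" "(K \<omega> \<longlongrightarrow> 1) at_top"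
    if "\<omega> \<in> space M" "s \<le> t" for \<omega> s t a
    using that G_mono G_right_cont G_bot G_top \<mu>.cdf_nondecreasing \<mu>.cdf_is_right_cont
      \<mu>.cdf_lim_at_bot \<mu>.cdf_lim_at_top_prob by (auto simp: K_def)
  define Q where "Q \<omega> = interval_measure (K \<omega>)" for \<omega>
  have Q: "real_distribution (Q \<omega>)" "cdf (Q \<omega>) = K \<omega>" if "\<omega> \<in> space M" for \<omega>
    unfolding Q_def using K[OF that order_refl] K(1)[OF that]
    by (auto intro!: real_distribution_interval_measure cdf_interval_measure)
  have [measurable]: "N \<in> sets M" using N by auto
  have Q_meas: "Q \<in> measurable M (prob_algebra borel)"
  proof (rule measurable_prob_algebra_cdf)
    have "(\<lambda>\<omega>. if \<omega> \<in> N then cdf \<mu> t else G \<omega> t) \<in> borel_measurable M" for t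
      by measurable
    moreover have "cdf (Q \<omega>) t = (if \<omega> \<in> N then cdf \<mu> t else G \<omega> t)" if "\<omega> \<in> space M" for \<omega> t
      using that by (simp add: Q K_def)
    ultimately show "(\<lambda>\<omega>. cdf (Q \<omega>) t) \<in> borel_measurable M" for t
      by (simp cong: measurable_cong)
  qed (rule Q)
  have "AE \<omega> in M. (\<lambda>k. X k \<omega> t) \<longlonglongrightarrow> cdf (Q \<omega>) t" for t
  proof -
    have ge: "AE \<omega> in M. 0 \<le> G \<omega> t - L \<omega> t"
      using conv[of t] convQ AE_space by eventually_elim (auto intro!: G_greatest L_mono)
    have int: "integrable M (\<lambda>\<omega>. G \<omega> t - L \<omega> t)"
      by (intro Bochner_Integration.integrable_diff integrable_const_bound[of _ 1]) (auto simp: G01 L01)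
    \<comment> \<open>For a rational \<open>q\<close> slightly to the right of \<open>t\<close>, the
      mean of \<open>G\<close> at \<open>t\<close> is at most that of \<open>L\<close> at
      \<open>q\<close>, which is \<open>cdf \<mu> q\<close>; right continuity of
      \<open>cdf \<mu>\<close> does the rest. As \<open>G\<close> dominates \<open>L\<close> at
      \<open>t\<close> almost surely, equal means force equality.\<close>
    have "(\<integral>\<omega>. G \<omega> t - L \<omega> t \<partial>M) \<le> e" if "0 < e" for e
    proof -
      have "\<forall>\<^sub>F x in at_right t. cdf \<mu> x < cdf \<mu> t + e"
        using \<mu>.cdf_is_right_cont[of t] \<open>0 < e\<close> unfolding continuous_within
        by (auto dest: order_tendstoD(2)[where a="cdf \<mu> t + e"])
      then obtain b where b: "t < b" "\<And>x. t < x \<Longrightarrow> x < b \<Longrightarrow> cdf \<mu> x < cdf \<mu> t + e"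
        by (auto simp: eventually_at_right_field)
      obtain q where q: "q \<in> \<rat>" "t < q" "q < b" using Rats_dense_in_real[OF b(1)] by blast
      have "(\<integral>\<omega>. G \<omega> t - L \<omega> t \<partial>M) \<le> (\<integral>\<omega>. L \<omega> q - L \<omega> t \<partial>M)"
        using int L_int G_le[OF q(1,2)] by (intro integral_mono) auto
      also have "\<dots> = cdf \<mu> q - cdf \<mu> t" using L_int by (simp add: mean_L)
      finally show ?thesis using b(2)[OF q(2,3)] by simp
    qed
    then have "(\<integral>\<omega>. G \<omega> t - L \<omega> t \<partial>M) \<le> 0" using field_le_epsilon[of _ "0::real"] by simp
    moreover have "0 \<le> (\<integral>\<omega>. G \<omega> t - L \<omega> t \<partial>M)" using ge by (rule integral_nonneg_AE)
    ultimately have "(\<integral>\<omega>. G \<omega> t - L \<omega> t \<partial>M) = 0" by simp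
    then have "AE \<omega> in M. G \<omega> t - L \<omega> t = 0"
      using integral_nonneg_eq_0_iff_AE[OF int ge] by simp
    moreover have "AE \<omega> in M. \<omega> \<notin> N" using N by (rule AE_not_in)
    ultimately show ?thesis
      using conv[of t] AE_space
    proof eventually_elim
      case (elim \<omega>)
      then show ?case using L[of \<omega> t] Q(2)[of \<omega>] by (simp add: K_def)
    qed
  qed
  with Q_meas show ?thesis by blast
qed

section \<open>Conditional kernels\<close>

text \<open>The law of \<open>(\<omega>, Y \<omega>)\<close> on the product of \<open>G\<close> with
  the Borel sets agrees on rectangles with the law that runs \<open>\<kappa>\<close> after
  \<open>M\<close>; rectangles are stable under intersection, so the two laws coincide. This permits
  integrands in which past and draw are entangled.\<close>

lemma (in prob_space) nn_integral_conditional_kernel: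
  fixes f :: "'a \<times> real \<Rightarrow> ennreal"
  assumes sub: "subalgebra M G"
    and \<kappa>: "\<kappa> \<in> measurable G (prob_algebra borel)"
    and Y [measurable]: "Y \<in> borel_measurable M"
    and cond: "\<And>B. B \<in> sets borel \<Longrightarrow>
      AE \<omega> in M. real_cond_exp M G (indicator (Y -` B \<inter> space M)) \<omega> = measure (\<kappa> \<omega>) B"
    and f: "f \<in> borel_measurable (G \<Otimes>\<^sub>M borel)"
  shows "(\<integral>\<^sup>+\<omega>. f (\<omega>, Y \<omega>) \<partial>M) = (\<integral>\<^sup>+\<omega>. \<integral>\<^sup>+y. f (\<omega>, y) \<partial>\<kappa> \<omega> \<partial>M)"
proof -
  interpret finite_measure_subalgebra M G by unfold_locales (rule sub)
  have space_G: "space G = space M" using sub by (simp add: subalgebra_def)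
  have G_M: "A \<in> sets M" if "A \<in> sets G" for A using sub that by (auto simp: subalgebra_def)
  define P where "P = G \<Otimes>\<^sub>M (borel :: real measure)"
  define M1 where "M1 = distr M P (\<lambda>\<omega>. (\<omega>, Y \<omega>))"
  define K where "K \<omega> = distr (\<kappa> \<omega>) P (Pair \<omega>)" for \<omega>
  \<comment> \<open>The kernel is known to be measurable only with respect to \<open>G\<close>, so
    \<open>bind\<close> runs over \<open>M\<close> restricted to \<open>G\<close>.\<close>
  define M2 where "M2 = restr_to_subalg M G \<bind> K"
  have id_meas: "(\<lambda>\<omega>. \<omega>) \<in> measurable M G"
    using measurable_from_subalg[OF sub] by (auto simp: measurable_def space_G intro: G_M)
  have pair_meas: "(\<lambda>\<omega>. (\<omega>, Y \<omega>)) \<in> measurable M P"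
    unfolding P_def by (intro measurable_Pair id_meas Y)
  have K_meas: "K \<in> measurable (restr_to_subalg M G) (subprob_algebra P)"
  proof -
    have "K \<in> measurable G (subprob_algebra P)"
      unfolding K_def P_def
      by (rule measurable_distr2[where M=borel]) (auto intro: measurable_prob_algebraD[OF \<kappa>])
    moreover have "sets (restr_to_subalg M G) = sets G" by (rule sets_restr_to_subalg[OF sub])
    ultimately show ?thesis by (simp cong: measurable_cong_sets)
  qed
  have ne: "space (restr_to_subalg M G) \<noteq> {}"
    using not_empty by (simp add: space_restr_to_subalg)
  have \<kappa>_prob: "prob_space (\<kappa> \<omega>)" "sets (\<kappa> \<omega>) = sets borel" if "\<omega> \<in> space M" for \<omega>
    using measurable_space[OF \<kappa>, of \<omega>] that by (simp_all add: space_G space_prob_algebra)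
  have Pair_meas: "Pair \<omega> \<in> measurable (\<kappa> \<omega>) P" if "\<omega> \<in> space M" for \<omega>
    using that measurable_Pair1'[of \<omega> G "borel :: real measure"] \<kappa>_prob[OF that]
    by (simp add: P_def space_G cong: measurable_cong_sets)
  have rect: "emeasure M1 (A \<times> B) = emeasure M2 (A \<times> B)" if A: "A \<in> sets G" and B: "B \<in> sets borel" for A B
  proof -
    note [measurable] = G_M[OF A] B
    have AB: "A \<times> B \<in> sets P" unfolding P_def using A B by simp
    have Asub: "A \<subseteq> space M" using A sets.sets_into_space space_G by blast
    let ?C = "Y -` B \<inter> space M"
    have "?C \<in> sets M" by measurable
    have mB: "(\<lambda>\<omega>. measure (\<kappa> \<omega>) B) \<in> borel_measurable G"
      using measure_measurable_prob_algebra2[of G "\<lambda>_. B" borel \<kappa>] \<kappa> B A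
      by simp
    then have mB': "(\<lambda>\<omega>. measure (\<kappa> \<omega>) B) \<in> borel_measurable M"
      using measurable_from_subalg[OF sub] by blast
    have "emeasure M1 (A \<times> B) = emeasure M (A \<inter> ?C)"
      unfolding M1_def using AB pair_meas Asub
      by (subst emeasure_distr) (auto intro!: arg_cong[where f="emeasure M"])
    also have "\<dots> = ennreal (\<integral>\<omega>. indicator A \<omega> * indicator ?C \<omega> \<partial>M)"
      using \<open>?C \<in> sets M\<close> G_M[OF A] Asub
      by (simp add: emeasure_eq_measure indicator_inter_arith[symmetric] Int_absorb2 le_infI1)
    \<comment> \<open>As \<open>A\<close> lies in \<open>G\<close>, its indicator passes through the
      conditional expectation. Only the single set \<open>B\<close> is involved, so a null set
      depending on \<open>B\<close> does no harm.\<close>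
    also have "(\<integral>\<omega>. indicator A \<omega> * indicator ?C \<omega> \<partial>M) =
        (\<integral>\<omega>. indicator A \<omega> * real_cond_exp M G (indicator ?C) \<omega> \<partial>M)"
    proof (rule real_cond_exp_intg(2)[symmetric])
      show "integrable M (\<lambda>\<omega>. indicator A \<omega> * indicator ?C \<omega> :: real)"
        by (rule integrable_const_bound[of _ 1]) (auto simp: indicator_def)
    qed (use A \<open>?C \<in> sets M\<close> in auto)
    also have "\<dots> = (\<integral>\<omega>. indicator A \<omega> * measure (\<kappa> \<omega>) B \<partial>M)"
      using cond[OF B] mB' by (intro integral_cong_AE) auto
    also have "ennreal \<dots> = (\<integral>\<^sup>+\<omega>. ennreal (indicator A \<omega> * measure (\<kappa> \<omega>) B) \<partial>M)"
    proof (intro nn_integral_eq_integral[symmetric] integrable_const_bound[of _ 1] AE_I2)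
      fix \<omega> assume "\<omega> \<in> space M"
      then interpret k: prob_space "\<kappa> \<omega>" by (rule \<kappa>_prob)
      show "norm (indicator A \<omega> * k.prob B) \<le> 1" by (simp add: indicator_def)
    qed (use mB' in auto)
    also have "\<dots> = (\<integral>\<^sup>+\<omega>. emeasure (K \<omega>) (A \<times> B) \<partial>M)"
    proof (rule nn_integral_cong)
      fix \<omega> assume \<omega>: "\<omega> \<in> space M"
      interpret k: prob_space "\<kappa> \<omega>" by (rule \<kappa>_prob[OF \<omega>])
      have "Pair \<omega> -` (A \<times> B) \<inter> space (\<kappa> \<omega>) = (if \<omega> \<in> A then B else {})"
        using sets_eq_imp_space_eq[OF \<kappa>_prob(2)[OF \<omega>]] by auto
      then show "ennreal (indicator A \<omega> * measure (\<kappa> \<omega>) B) = emeasure (K \<omega>) (A \<times> B)"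
        unfolding K_def using AB Pair_meas[OF \<omega>]
        by (subst emeasure_distr) (auto simp: k.emeasure_eq_measure)
    qed
    also have "\<dots> = (\<integral>\<^sup>+\<omega>. emeasure (K \<omega>) (A \<times> B) \<partial>restr_to_subalg M G)"
    proof (rule nn_integral_subalgebra2[symmetric, OF sub])
      have "(\<lambda>\<omega>. emeasure (K \<omega>) (A \<times> B)) \<in> borel_measurable (restr_to_subalg M G)"
        using measurable_emeasure_kernel[OF K_meas AB] .
      then show "(\<lambda>\<omega>. emeasure (K \<omega>) (A \<times> B)) \<in> borel_measurable G"
        by (simp add: sets_restr_to_subalg[OF sub] cong: measurable_cong_sets)
    qed
    also have "\<dots> = emeasure M2 (A \<times> B)"
      unfolding M2_def using emeasure_bind[OF ne K_meas AB] by simp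
    finally show ?thesis .
  qed
  have eq: "M1 = M2"
  proof (rule measure_eqI_generator_eq)
    let ?E = "{A \<times> B | A B. A \<in> sets G \<and> B \<in> sets (borel :: real measure)}"
    show "Int_stable ?E" by (rule Int_stable_pair_measure_generator)
    show "?E \<subseteq> Pow (space G \<times> UNIV)" using pair_measure_closed[of G "borel :: real measure"] by simp
    show "sets M1 = sigma_sets (space G \<times> UNIV) ?E"
      by (simp add: M1_def P_def sets_pair_measure)
    show "sets M2 = sigma_sets (space G \<times> UNIV) ?E"
      unfolding M2_def using sets_bind[OF sets_kernel[OF K_meas] ne]
      by (simp add: P_def sets_pair_measure)
    show "\<And>X. X \<in> ?E \<Longrightarrow> emeasure M1 X = emeasure M2 X" using rect by auto
    show "range (\<lambda>_::nat. space G \<times> UNIV) \<subseteq> ?E"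
      by (intro image_subsetI CollectI exI conjI, rule refl) auto
    interpret M1: prob_space M1 unfolding M1_def by (rule prob_space_distr[OF pair_meas])
    show "\<And>i::nat. emeasure M1 (space G \<times> UNIV) \<noteq> \<infinity>" by simp
  qed auto
  have fP: "f \<in> borel_measurable P" using f by (simp add: P_def)
  have "(\<integral>\<^sup>+\<omega>. f (\<omega>, Y \<omega>) \<partial>M) = integral\<^sup>N M1 f"
    unfolding M1_def using pair_meas fP by (simp add: nn_integral_distr)
  also have "\<dots> = (\<integral>\<^sup>+\<omega>. integral\<^sup>N (K \<omega>) f \<partial>restr_to_subalg M G)"
    unfolding eq M2_def by (rule nn_integral_bind[OF fP K_meas])
  also have "\<dots> = (\<integral>\<^sup>+\<omega>. integral\<^sup>N (K \<omega>) f \<partial>M)"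
  proof (rule nn_integral_subalgebra2[OF sub])
    have "(\<lambda>\<omega>. integral\<^sup>N (K \<omega>) f) \<in> borel_measurable (restr_to_subalg M G)"
      using measurable_compose[OF K_meas nn_integral_measurable_subprob_algebra[OF fP]] .
    then show "(\<lambda>\<omega>. integral\<^sup>N (K \<omega>) f) \<in> borel_measurable G"
      by (simp add: sets_restr_to_subalg[OF sub] cong: measurable_cong_sets)
  qed
  also have "\<dots> = (\<integral>\<^sup>+\<omega>. \<integral>\<^sup>+y. f (\<omega>, y) \<partial>\<kappa> \<omega> \<partial>M)"
    unfolding K_def using fP Pair_meas by (intro nn_integral_cong) (simp add: nn_integral_distr)
  finally show ?thesis .
qed

section \<open>The generated filtration and the learning rates\<close>

lemma generated_by_measurable:
  "i \<in> I \<Longrightarrow> y i \<in> borel_measurable (generated_by M I y)"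
proof -
  assume i: "i \<in> I"
  have "(\<lambda>\<omega>. \<lambda>i\<in>I. y i \<omega>) \<in> measurable (generated_by M I y) (PiM I (\<lambda>_. borel))"
    unfolding generated_by_def by (rule measurable_vimage_algebra1) (auto simp: space_PiM)
  from measurable_compose[OF this measurable_component_singleton[OF i]] i show ?thesis by simp
qed

lemma space_generated_by [simp]: "space (generated_by M I y) = space M"
  by (simp add: generated_by_def)

lemma sets_generated_by_subset:
  assumes "space N = space M" "\<And>i. i \<in> I \<Longrightarrow> y i \<in> borel_measurable N"
  shows "sets (generated_by M I y) \<subseteq> sets N"
  unfolding generated_by_def using assms
  by (intro sets_image_in_sets measurable_restrict) auto

text \<open>For \<open>i \<ge> 1\<close> the ratio \<open>2 / (i + 1)\<close> is at most 1. Through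
  \<open>n \<ge> 1\<close> this makes every update of the scheme a convex combination.\<close>

lemma learning_rate_bounds:
  assumes "1 \<le> i" "0 \<le> \<beta>" shows "learning_rate \<beta> i \<in> {0..1}"
proof -
  have "2 powr \<beta> \<le> real (i + 1) powr \<beta>" using assms by (intro powr_mono2) auto
  then show ?thesis using assms
    by (simp add: learning_rate_def powr_minus field_simps)
qed

lemma summable_learning_rate_square:
  assumes "1/2 < \<beta>" shows "summable (\<lambda>k. (learning_rate \<beta> (n + k))\<^sup>2)"
proof -
  have "summable (\<lambda>i. real i powr (- 2 * \<beta>))"
    using assms by (simp add: summable_real_powr_iff)
  then have "summable (\<lambda>k. (2 powr \<beta>)\<^sup>2 * real (k + (n + 1)) powr (- 2 * \<beta>))"
    by (intro summable_mult) (rule summable_ignore_initial_segment)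
  moreover have "(2 powr \<beta>)\<^sup>2 * real (k + (n + 1)) powr (- 2 * \<beta>) = (learning_rate \<beta> (n + k))\<^sup>2" for k
    by (simp add: learning_rate_def power_mult_distrib powr_power ac_simps)
  ultimately show ?thesis by (simp only:)
qed

section \<open>The sampling scheme\<close>

locale copula_sampling = prob_space M for M :: "'w measure" +
  fixes n :: nat and \<rho> \<beta> :: real and \<mu>0 :: "real measure"
    and y :: "nat \<Rightarrow> 'w \<Rightarrow> real" and P :: "nat \<Rightarrow> 'w \<Rightarrow> real \<Rightarrow> real"
  assumes n: "1 \<le> n" and \<rho>: "0 < \<rho>" "\<rho> < 1" and \<beta>: "1/2 < \<beta>"
    and \<mu>0: "real_distribution \<mu>0" and abs_cont: "absolutely_continuous lborel \<mu>0"
    and scheme: "copula_forward_sampling M n \<rho> \<beta> (cdf \<mu>0) y P"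
begin

sublocale \<mu>0: real_distribution \<mu>0 by (rule \<mu>0)

text \<open>With \<open>k\<close> counted from 0, this is the weight of the step from
  \<open>P k\<close> to \<open>P (Suc k)\<close>, whose index is
  \<open>n + Suc k - 1\<close>.\<close>

definition "\<alpha> k = learning_rate \<beta> (n + k)"

lemma \<alpha>_bounds: "0 \<le> \<alpha> k" "\<alpha> k \<le> 1"
  using learning_rate_bounds[of "n + k" \<beta>] n \<beta> by (auto simp: \<alpha>_def)

lemma \<alpha>_pos: "0 < \<alpha> k"
  by (simp add: \<alpha>_def learning_rate_def)

text \<open>A version of \<open>P\<close> built from \<^const>\<open>regular_copula\<close>. It is a continuous CDF for every
  \<open>\<omega>\<close>, whereas \<open>P\<close> need not be one when some \<open>P\<^sub>k\<^sub>-\<^sub>1(y\<^sub>n\<^sub>+\<^sub>k)\<close> is \<open>0\<close> or \<open>1\<close>.\<close>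

primrec R :: "nat \<Rightarrow> 'w \<Rightarrow> real \<Rightarrow> real" where
  "R 0 \<omega> t = cdf \<mu>0 t"
| "R (Suc k) \<omega> t =
     (1 - \<alpha> k) * R k \<omega> t + \<alpha> k * regular_copula \<rho> (R k \<omega> t) (R k \<omega> (y (n + Suc k) \<omega>))"

lemma R_bounds: "R k \<omega> t \<in> {0..1}"
proof (induction k arbitrary: t)
  case 0
  then show ?case by (simp add: \<mu>0.cdf_nonneg \<mu>0.cdf_bounded_prob)
next
  case (Suc k)
  have "(1 - \<alpha> k) *\<^sub>R R k \<omega> t + \<alpha> k *\<^sub>R regular_copula \<rho> (R k \<omega> t) (R k \<omega> (y (n + Suc k) \<omega>)) \<in> {0..1}"
    using convex_real_interval(5)[of 0 "1::real"] Suc[of t] regular_copula_bounds \<alpha>_bounds[of k]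
    by (intro convexD_alt) auto
  then show ?case by simp
qed

lemma R_mono: "s \<le> t \<Longrightarrow> R k \<omega> s \<le> R k \<omega> t"
proof (induction k)
  case (Suc k)
  then show ?case using \<alpha>_bounds[of k]
    by (auto intro!: add_mono mult_left_mono regular_copula_mono[OF \<rho>])
qed (simp add: \<mu>0.cdf_nondecreasing)

lemma isCont_regular_copula: "isCont (\<lambda>u. regular_copula \<rho> u v) u"
  using continuous_on_regular_copula[OF \<rho>] by (simp add: continuous_on_eq_continuous_at)

lemma R_0: "R 0 \<omega> = cdf \<mu>0"
  and R_Suc: "R (Suc k) \<omega> = (\<lambda>t.
    (1 - \<alpha> k) * R k \<omega> t + \<alpha> k * regular_copula \<rho> (R k \<omega> t) (R k \<omega> (y (n + Suc k) \<omega>)))"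
  by (simp_all add: fun_eq_iff)

lemma isCont_R: "isCont (R k \<omega>) t"
proof (induction k arbitrary: t)
  case 0
  show ?case unfolding R_0 by (rule \<mu>0.absolutely_continuous_isCont_cdf[OF abs_cont])
next
  case (Suc k)
  show ?case unfolding R_Suc
    by (intro continuous_intros Suc isCont_o2[OF Suc isCont_regular_copula])
qed

text \<open>The levels 0 and 1 are fixed by the copula whatever its second argument, so the limits
  of the initial CDF at both ends survive every update.\<close>

lemma R_tendsto:
  assumes "regular_copula \<rho> l = (\<lambda>v. l)" and "(cdf \<mu>0 \<longlongrightarrow> l) F"
  shows "(R k \<omega> \<longlongrightarrow> l) F"
proof (induction k)
  case 0
  show ?case unfolding R_0 by fact
next
  case (Suc k)
  have "(R (Suc k) \<omega> \<longlongrightarrow> (1 - \<alpha> k) * l + \<alpha> k * regular_copula \<rho> l (R k \<omega> (y (n + Suc k) \<omega>))) F"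
    unfolding R_Suc by (intro tendsto_intros Suc isCont_tendsto_compose[OF isCont_regular_copula])
  then show ?case by (simp add: assms(1) algebra_simps del: R.simps)
qed

lemma R_at_bot: "(R k \<omega> \<longlongrightarrow> 0) at_bot"
  and R_at_top: "(R k \<omega> \<longlongrightarrow> 1) at_top"
  by (intro R_tendsto ext; simp add: regular_copula_0[OF \<rho>] regular_copula_1[OF \<rho>]
      \<mu>0.cdf_lim_at_bot \<mu>0.cdf_lim_at_top_prob)+

definition "\<kappa> k \<omega> = interval_measure (R k \<omega>)"

lemma R_right_continuous: "continuous (at_right a) (R k \<omega>)"
  by (rule continuous_at_imp_continuous_at_within[OF isCont_R])

lemma \<kappa>_distribution: "real_distribution (\<kappa> k \<omega>)"
  unfolding \<kappa>_def
  by (rule real_distribution_interval_measure[OF R_mono R_right_continuous R_at_bot R_at_top])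

lemma cdf_\<kappa>: "cdf (\<kappa> k \<omega>) = R k \<omega>"
  unfolding \<kappa>_def by (rule cdf_interval_measure[OF R_mono R_right_continuous R_at_bot])

text \<open>Indexed by the number of draws already made: \<open>R k\<close> is known at
  \<open>\<F> k\<close>, the draw \<open>y (n + Suc k)\<close> only at
  \<open>\<F> (Suc k)\<close>.\<close>

definition "\<F> k = generated_by M {n+1..<n + Suc k} y"

lemma space_\<F> [simp]: "space (\<F> k) = space M" by (simp add: \<F>_def)

lemma P_Suc:
  assumes "\<omega> \<in> space M"
  shows "P (Suc k) \<omega> t =
    (1 - \<alpha> k) * P k \<omega> t + \<alpha> k * copula_H \<rho> (P k \<omega> t) (P k \<omega> (y (n + Suc k) \<omega>))"
proof -
  have "\<forall>k\<ge>1. \<forall>\<omega>\<in>space M. \<forall>t. P k \<omega> t =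
      (1 - learning_rate \<beta> (n+k-1)) * P (k-1) \<omega> t
      + learning_rate \<beta> (n+k-1) * copula_H \<rho> (P (k-1) \<omega> t) (P (k-1) \<omega> (y (n+k) \<omega>))"
    using scheme unfolding copula_forward_sampling_def by blast
  from this[THEN spec, of "Suc k"] assms show ?thesis by (simp add: \<alpha>_def)
qed

lemma drawn: "drawn_from_cdf M (\<F> k) (y (n + Suc k)) (P k)"
proof -
  have "\<forall>k\<ge>1. drawn_from_cdf M (generated_by M {n+1..<n+k} y) (y (n+k)) (P (k-1))"
    using scheme unfolding copula_forward_sampling_def by blast
  from this[THEN spec, of "Suc k"] show ?thesis by (simp add: \<F>_def)
qed

lemma y_measurable: "y (n + Suc k) \<in> borel_measurable M"
  using drawn unfolding drawn_from_cdf_def by blast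

lemma y_measurable_\<F>: "k < j \<Longrightarrow> y (n + Suc k) \<in> borel_measurable (\<F> j)"
  unfolding \<F>_def by (rule generated_by_measurable) auto

lemma subalgebra_\<F>: "subalgebra M (\<F> k)"
  unfolding subalgebra_def \<F>_def
proof (intro conjI sets_generated_by_subset)
  show "y i \<in> borel_measurable M" if "i \<in> {n + 1..<n + Suc k}" for i
    using that y_measurable[of "i - Suc n"] by auto
qed simp_all

lemma \<F>_mono: "i \<le> j \<Longrightarrow> sets (\<F> i) \<subseteq> sets (\<F> j)"
  unfolding \<F>_def by (intro sets_generated_by_subset generated_by_measurable) auto

lemma measurable_\<F>_mono:
  assumes "f \<in> measurable (\<F> i) N" "i \<le> j" shows "f \<in> measurable (\<F> j) N"
  using assms \<F>_mono[OF assms(2)] by (auto simp: measurable_def)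

text \<open>Measurability in \<open>\<omega>\<close> for each fixed \<open>t\<close> would not
  suffice, because the recursion evaluates \<open>R k\<close> at the random point
  \<open>y (n + Suc k) \<omega>\<close>.\<close>

lemma R_measurable_pair: "(\<lambda>(\<omega>, t). R k \<omega> t) \<in> borel_measurable (\<F> k \<Otimes>\<^sub>M borel)"
proof (induction k)
  case 0
  have [measurable]: "cdf \<mu>0 \<in> borel_measurable borel"
    by (intro borel_measurable_mono monoI \<mu>0.cdf_nondecreasing)
  show ?case by simp
next
  case (Suc k)
  have "(\<lambda>\<omega>. \<omega>) \<in> measurable (\<F> (Suc k)) (\<F> k)"
    using \<F>_mono[of k "Suc k"] by (auto simp: measurable_def)
  then have pair: "(\<lambda>x. (fst x, g x)) \<in> measurable (\<F> (Suc k) \<Otimes>\<^sub>M borel) (\<F> k \<Otimes>\<^sub>M borel)"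
    if "g \<in> borel_measurable (\<F> (Suc k) \<Otimes>\<^sub>M borel)" for g :: "'w \<times> real \<Rightarrow> real"
    using that by (intro measurable_Pair measurable_compose[OF measurable_fst])
  have R: "(\<lambda>x. R k (fst x) (g x)) \<in> borel_measurable (\<F> (Suc k) \<Otimes>\<^sub>M borel)"
    if "g \<in> borel_measurable (\<F> (Suc k) \<Otimes>\<^sub>M borel)" for g :: "'w \<times> real \<Rightarrow> real"
    using measurable_compose[OF pair[OF that] Suc] by (simp only: prod.case)
  have "(\<lambda>x. y (n + Suc k) (fst x)) \<in> borel_measurable (\<F> (Suc k) \<Otimes>\<^sub>M borel)"
    using y_measurable_\<F>[of k "Suc k"] by (intro measurable_compose[OF measurable_fst]) auto
  then show ?case unfolding R.simps case_prod_beta'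
    by (intro borel_measurable_add borel_measurable_times borel_measurable_const
        regular_copula_measurable[OF \<rho>] R measurable_snd)
qed

lemma R_measurable_\<F>: "(\<lambda>\<omega>. R k \<omega> t) \<in> borel_measurable (\<F> k)"
  using measurable_compose[OF _ R_measurable_pair, of "\<lambda>\<omega>. (\<omega>, t)" "\<F> k" k] by simp

lemma R_measurable [measurable]: "(\<lambda>\<omega>. R k \<omega> t) \<in> borel_measurable M"
  by (rule measurable_from_subalg[OF subalgebra_\<F> R_measurable_\<F>])

lemma \<kappa>_measurable: "\<kappa> k \<in> measurable (\<F> k) (prob_algebra borel)"
  by (rule measurable_prob_algebra_cdf) (simp_all add: \<kappa>_distribution cdf_\<kappa> R_measurable_\<F>)

text \<open>The equality of \<open>P k\<close> and \<open>R k\<close> is a premise because its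
  inductive proof uses this formula at stage \<open>k\<close> to reach \<open>k + 1\<close>.\<close>

lemma nn_integral_kernel:
  assumes "AE \<omega> in M. P k \<omega> = R k \<omega>" and "f \<in> borel_measurable (\<F> k \<Otimes>\<^sub>M borel)"
  shows "(\<integral>\<^sup>+\<omega>. f (\<omega>, y (n + Suc k) \<omega>) \<partial>M) = (\<integral>\<^sup>+\<omega>. \<integral>\<^sup>+v. f (\<omega>, v) \<partial>\<kappa> k \<omega> \<partial>M)"
proof (rule nn_integral_conditional_kernel[OF subalgebra_\<F> \<kappa>_measurable y_measurable _ assms(2)])
  fix B :: "real set" assume "B \<in> sets borel"
  then have "AE \<omega> in M. real_cond_exp M (\<F> k) (indicator (y (n + Suc k) -` B \<inter> space M)) \<omega> =
      measure (interval_measure (P k \<omega>)) B"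
    using drawn unfolding drawn_from_cdf_def by blast
  with assms(1) show "AE \<omega> in M. real_cond_exp M (\<F> k) (indicator (y (n + Suc k) -` B \<inter> space M)) \<omega> =
      measure (\<kappa> k \<omega>) B"
    by eventually_elim (simp add: \<kappa>_def)
qed

text \<open>Given the equality at \<open>k\<close>, the next draw comes from the continuous CDF
  \<open>R k\<close>, so \<open>R k\<close> at the draw lies strictly between 0 and 1 almost surely.
  There the two copulas agree, and so do the updates.\<close>

lemma P_eq_R: "AE \<omega> in M. P k \<omega> = R k \<omega>"
proof (induction k)
  case 0
  then show ?case using scheme by (intro AE_I2) (auto simp: copula_forward_sampling_def)
next
  case (Suc k)
  let ?bad = "\<lambda>(\<omega>, v). \<not> (0 < R k \<omega> v \<and> R k \<omega> v < 1)"
  note [measurable] = R_measurable_pair[of k]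
  have bad: "Measurable.pred (\<F> k \<Otimes>\<^sub>M borel) ?bad"
    using R_measurable_pair[of k] unfolding case_prod_beta' by measurable
  define f where "f x = (if ?bad x then 1 else 0 :: ennreal)" for x
  have f [measurable]: "f \<in> borel_measurable (\<F> k \<Otimes>\<^sub>M borel)"
    unfolding f_def using bad by measurable
  have "(\<integral>\<^sup>+v. f (\<omega>, v) \<partial>\<kappa> k \<omega>) = 0" for \<omega>
  proof -
    interpret k: real_distribution "\<kappa> k \<omega>" by (rule \<kappa>_distribution)
    have "AE v in \<kappa> k \<omega>. f (\<omega>, v) = 0"
      using k.AE_cdf_in_01 isCont_R by (simp add: cdf_\<kappa> f_def)
    then have "(\<integral>\<^sup>+v. f (\<omega>, v) \<partial>\<kappa> k \<omega>) = (\<integral>\<^sup>+v. 0 \<partial>\<kappa> k \<omega>)" by (rule nn_integral_cong_AE)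
    then show ?thesis by simp
  qed
  then have 0: "(\<integral>\<^sup>+\<omega>. f (\<omega>, y (n + Suc k) \<omega>) \<partial>M) = 0"
    using nn_integral_kernel[OF Suc f] by simp
  have "(\<lambda>\<omega>. (\<omega>, y (n + Suc k) \<omega>)) \<in> measurable M (\<F> k \<Otimes>\<^sub>M borel)"
    using measurable_from_subalg[OF subalgebra_\<F>] y_measurable[of k] subalgebra_\<F>[of k]
    by (intro measurable_Pair) (auto simp: measurable_def subalgebra_def)
  then have "(\<lambda>\<omega>. f (\<omega>, y (n + Suc k) \<omega>)) \<in> borel_measurable M"
    by (rule measurable_compose[OF _ f])
  then have "AE \<omega> in M. f (\<omega>, y (n + Suc k) \<omega>) = 0"
    using 0 by (subst (asm) nn_integral_0_iff_AE) auto
  then show ?case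
    using Suc AE_space
  proof eventually_elim
    case (elim \<omega>)
    then have "0 < R k \<omega> (y (n + Suc k) \<omega>)" "R k \<omega> (y (n + Suc k) \<omega>) < 1"
      by (auto simp: f_def split: if_splits)
    then have "P (Suc k) \<omega> t = R (Suc k) \<omega> t" for t
      using elim by (simp only: P_Suc R.simps regular_copula_eq[OF R_bounds])
    then show ?case by blast
  qed
qed

text \<open>Common source of both limits: \<open>g\<close> is the copula value with the learning
  rates as weights, or the indicator of \<open>{..t}\<close> with weights
  \<open>1 / (k + 1)\<close>. An innovation is a difference of two numbers in [0,1], so
  \<open>w k\<close> bounds the weighted one.\<close>

lemma AE_summable_innovations:
  assumes g: "\<And>k. g k \<in> borel_measurable (\<F> k \<Otimes>\<^sub>M borel)"
    and g_bounds: "\<And>k x. g k x \<in> {0..1}"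
    and g_mean: "\<And>k \<omega>. \<omega> \<in> space M \<Longrightarrow> (\<integral>\<^sup>+v. ennreal (g k (\<omega>, v)) \<partial>\<kappa> k \<omega>) = ennreal (R k \<omega> t)"
    and w: "\<And>k. 0 \<le> w k" "summable (\<lambda>k. (w k)\<^sup>2)"
  shows "AE \<omega> in M. summable (\<lambda>k. w k * (g k (\<omega>, y (n + Suc k) \<omega>) - R k \<omega> t))"
    and "(\<integral>\<omega>. g k (\<omega>, y (n + Suc k) \<omega>) \<partial>M) = (\<integral>\<omega>. R k \<omega> t \<partial>M)"
proof -
  define Z where "Z k \<omega> = g k (\<omega>, y (n + Suc k) \<omega>)" for k \<omega>
  have Z_adapted: "Z k \<in> borel_measurable (\<F> (Suc k))" for k
  proof -
    have "(\<lambda>\<omega>. (\<omega>, y (n + Suc k) \<omega>)) \<in> measurable (\<F> (Suc k)) (\<F> k \<Otimes>\<^sub>M borel)"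
      using y_measurable_\<F>[of k "Suc k"] \<F>_mono[of k "Suc k"]
      by (intro measurable_Pair) (auto simp: measurable_def)
    then show ?thesis unfolding Z_def by (rule measurable_compose[OF _ g])
  qed
  have [measurable]: "Z k \<in> borel_measurable M" for k
    by (rule measurable_from_subalg[OF subalgebra_\<F> Z_adapted])
  have Z_bounds: "0 \<le> Z k \<omega>" "Z k \<omega> \<le> 1" for k \<omega>
    using g_bounds[of k] by (auto simp: Z_def)
  have R_bounds': "0 \<le> R k \<omega> t" "R k \<omega> t \<le> 1" for k \<omega> using R_bounds[of k \<omega> t] by auto
  have mean: "(\<integral>\<omega>. indicator A \<omega> * Z k \<omega> \<partial>M) = (\<integral>\<omega>. indicator A \<omega> * R k \<omega> t \<partial>M)"
    if A: "A \<in> sets (\<F> k)" for A k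
  proof -
    have [measurable]: "A \<in> sets M" using A subalgebra_\<F> by (auto simp: subalgebra_def)
    \<comment> \<open>Placing the indicator of \<open>A\<close> inside the integrand turns the
      kernel formula into a statement about conditional means given \<open>\<F> k\<close>.\<close>
    have f: "(\<lambda>x. indicator A (fst x) * ennreal (g k x)) \<in> borel_measurable (\<F> k \<Otimes>\<^sub>M borel)"
      using g[of k] A by measurable
    have "(\<integral>\<^sup>+\<omega>. ennreal (indicator A \<omega> * Z k \<omega>) \<partial>M) = (\<integral>\<^sup>+\<omega>. indicator A \<omega> * ennreal (Z k \<omega>) \<partial>M)"
      by (intro nn_integral_cong) (simp add: indicator_def)
    also have "\<dots> = (\<integral>\<^sup>+\<omega>. \<integral>\<^sup>+v. indicator A \<omega> * ennreal (g k (\<omega>, v)) \<partial>\<kappa> k \<omega> \<partial>M)"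
      using nn_integral_kernel[OF P_eq_R f] by (simp add: Z_def)
    also have "\<dots> = (\<integral>\<^sup>+\<omega>. ennreal (indicator A \<omega> * R k \<omega> t) \<partial>M)"
      using g_mean by (intro nn_integral_cong) (simp add: indicator_def)
    finally have *: "(\<integral>\<^sup>+\<omega>. ennreal (indicator A \<omega> * Z k \<omega>) \<partial>M) = (\<integral>\<^sup>+\<omega>. ennreal (indicator A \<omega> * R k \<omega> t) \<partial>M)" .
    show ?thesis
      using Z_bounds R_bounds' by (subst (1 2) integral_eq_nn_integral) (auto simp: *)
  qed
  from mean[of "space M" k] show "(\<integral>\<omega>. g k (\<omega>, y (n + Suc k) \<omega>) \<partial>M) = (\<integral>\<omega>. R k \<omega> t \<partial>M)"
    using sets.top[of "\<F> k"] by (simp add: Z_def cong: Bochner_Integration.integral_cong)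
  interpret square_summable_differences M \<F> "\<lambda>k \<omega>. w k * (Z k \<omega> - R k \<omega> t)" w
  proof
    show "subalgebra M (\<F> i)" "i \<le> j \<Longrightarrow> sets (\<F> i) \<subseteq> sets (\<F> j)" for i j
      by (rule subalgebra_\<F>, rule \<F>_mono)
    show "(\<lambda>\<omega>. w k * (Z k \<omega> - R k \<omega> t)) \<in> borel_measurable (\<F> (Suc k))" for k
      using Z_adapted[of k] measurable_\<F>_mono[OF R_measurable_\<F>, of k "Suc k"] by simp
    show "\<bar>w k * (Z k \<omega> - R k \<omega> t)\<bar> \<le> w k" for k \<omega>
      using w(1)[of k] Z_bounds[of k \<omega>] R_bounds'[of k \<omega>] by (simp add: abs_mult mult_left_le)
    show "summable (\<lambda>k. (w k)\<^sup>2)" by fact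
    show "(\<integral>\<omega>. indicator A \<omega> * (w k * (Z k \<omega> - R k \<omega> t)) \<partial>M) = 0" if A: "A \<in> sets (\<F> k)" for A k
    proof -
      have [measurable]: "A \<in> sets M" using A subalgebra_\<F> by (auto simp: subalgebra_def)
      have int: "integrable M (\<lambda>\<omega>. indicator A \<omega> * Z k \<omega>)" "integrable M (\<lambda>\<omega>. indicator A \<omega> * R k \<omega> t)"
        using Z_bounds R_bounds' by (auto intro!: integrable_const_bound[of _ 1] simp: indicator_def)
      have "(\<integral>\<omega>. indicator A \<omega> * (w k * (Z k \<omega> - R k \<omega> t)) \<partial>M) =
          (\<integral>\<omega>. w k * (indicator A \<omega> * Z k \<omega> - indicator A \<omega> * R k \<omega> t) \<partial>M)"
        by (simp add: algebra_simps)
      also have "\<dots> = w k * ((\<integral>\<omega>. indicator A \<omega> * Z k \<omega> \<partial>M) - (\<integral>\<omega>. indicator A \<omega> * R k \<omega> t \<partial>M))"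
        using int by simp
      finally show ?thesis using mean[OF A] by simp
    qed
  qed
  show "AE \<omega> in M. summable (\<lambda>k. w k * (g k (\<omega>, y (n + Suc k) \<omega>) - R k \<omega> t))"
    using AE_summable by (simp add: Z_def)
qed

text \<open>The one-step martingale property: given the past, \<open>R k \<omega> t\<close> is a
  constant \<open>u\<close>, and the copula identity applies to the distribution with CDF
  \<open>R k \<omega>\<close>.\<close>

lemma copula_innovation:
  defines "g \<equiv> \<lambda>t k (\<omega>, v). regular_copula \<rho> (R k \<omega> t) (R k \<omega> v)"
  shows "g t k \<in> borel_measurable (\<F> k \<Otimes>\<^sub>M borel)"
    and "(\<integral>\<^sup>+v. ennreal (g t k (\<omega>, v)) \<partial>\<kappa> k \<omega>) = ennreal (R k \<omega> t)"
proof -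
  show "g t k \<in> borel_measurable (\<F> k \<Otimes>\<^sub>M borel)"
    using R_measurable_pair[of k] unfolding g_def case_prod_beta'
    by (intro regular_copula_measurable[OF \<rho>] measurable_compose[OF measurable_fst R_measurable_\<F>])
  interpret k: real_distribution "\<kappa> k \<omega>" by (rule \<kappa>_distribution)
  show "(\<integral>\<^sup>+v. ennreal (g t k (\<omega>, v)) \<partial>\<kappa> k \<omega>) = ennreal (R k \<omega> t)"
    using k.nn_integral_regular_copula[OF \<rho>, of "R k \<omega> t"] isCont_R R_bounds
    by (simp add: g_def cdf_\<kappa>)
qed

lemma R_Suc_diff:
  "R (Suc k) \<omega> t - R k \<omega> t = \<alpha> k * (regular_copula \<rho> (R k \<omega> t) (R k \<omega> (y (n + Suc k) \<omega>)) - R k \<omega> t)"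
  by (simp add: algebra_simps)

lemma summable_\<alpha>: "summable (\<lambda>k. (\<alpha> k)\<^sup>2)"
  unfolding \<alpha>_def by (rule summable_learning_rate_square[OF \<beta>])

lemma AE_convergent_R: "AE \<omega> in M. convergent (\<lambda>k. R k \<omega> t)"
proof -
  have "AE \<omega> in M. summable (\<lambda>k. R (Suc k) \<omega> t - R k \<omega> t)"
    using AE_summable_innovations(1)[OF copula_innovation(1) _ copula_innovation(2) \<alpha>_bounds(1) summable_\<alpha>, of t]
      regular_copula_bounds by (simp add: R_Suc_diff case_prod_beta' del: R.simps)
  then show ?thesis
  proof eventually_elim
    case (elim \<omega>)
    then have "convergent (\<lambda>N. (\<Sum>k<N. R (Suc k) \<omega> t - R k \<omega> t) + R 0 \<omega> t)"
      unfolding summable_iff_convergent by (intro convergent_add convergent_const)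
    then show ?case
      by (simp add: sum_lessThan_telescope[of "\<lambda>k. R k \<omega> t"] del: R.simps)
  qed
qed

lemma expectation_R: "(\<integral>\<omega>. R k \<omega> t \<partial>M) = cdf \<mu>0 t"
proof (induction k)
  case 0
  then show ?case by (simp add: prob_space)
next
  case (Suc k)
  define Z where "Z \<omega> = regular_copula \<rho> (R k \<omega> t) (R k \<omega> (y (n + Suc k) \<omega>))" for \<omega>
  have Z: "(\<integral>\<omega>. Z \<omega> \<partial>M) = (\<integral>\<omega>. R k \<omega> t \<partial>M)"
    using AE_summable_innovations(2)[OF copula_innovation(1) _ copula_innovation(2) \<alpha>_bounds(1) summable_\<alpha>, of t]
      regular_copula_bounds by (simp add: Z_def case_prod_beta')
  have [measurable]: "Z \<in> borel_measurable M"
  proof -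
    \<comment> \<open>Solving the recursion for \<open>Z\<close> reduces its measurability to that
      of \<open>R\<close>; the division needs \<open>\<alpha> k > 0\<close>.\<close>
    have "Z = (\<lambda>\<omega>. (R (Suc k) \<omega> t - (1 - \<alpha> k) * R k \<omega> t) / \<alpha> k)"
      using \<alpha>_pos[of k] by (simp add: Z_def fun_eq_iff)
    then show ?thesis by (simp del: R.simps)
  qed
  have "integrable M Z" "integrable M (\<lambda>\<omega>. R k \<omega> t)"
    using regular_copula_bounds R_bounds[of k _ t]
    by (auto intro!: integrable_const_bound[of _ 1] AE_I2 simp: Z_def)
  then have "(\<integral>\<omega>. (1 - \<alpha> k) * R k \<omega> t + \<alpha> k * Z \<omega> \<partial>M) = (1 - \<alpha> k) * cdf \<mu>0 t + \<alpha> k * cdf \<mu>0 t"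
    using Suc Z by simp
  then show ?case by (simp add: Z_def left_diff_distrib)
qed

text \<open>The indicator of \<open>{..t}\<close> at the new draw has conditional mean
  \<open>R k \<omega> t\<close>, so the innovations weighted by \<open>1 / (k + 1)\<close> are
  summable, which is the form Kronecker's lemma asks for.\<close>

lemma AE_empirical:
  "AE \<omega> in M. (\<lambda>N. (\<Sum>k<N. indicator {..t} (y (n + Suc k) \<omega>) - R k \<omega> t) / real N) \<longlonglongrightarrow> 0"
proof -
  have "AE \<omega> in M. summable (\<lambda>k. inverse (real (Suc k)) *
      ((\<lambda>(\<omega>, v). indicator {..t} v) (\<omega>, y (n + Suc k) \<omega>) - R k \<omega> t))"
  proof (rule AE_summable_innovations(1))
    show "(\<integral>\<^sup>+v. ennreal ((\<lambda>(\<omega>, v). indicator {..t} v) (\<omega>, v)) \<partial>\<kappa> k \<omega>) = ennreal (R k \<omega> t)" for k \<omega>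
    proof -
      interpret k: real_distribution "\<kappa> k \<omega>" by (rule \<kappa>_distribution)
      show ?thesis
        by (simp add: ennreal_indicator k.emeasure_eq_measure cdf_def2[symmetric] cdf_\<kappa>)
    qed
    show "summable (\<lambda>k. (inverse (real (Suc k)))\<^sup>2)"
      using summable_ignore_initial_segment[OF inverse_power_summable[of 2], of 1]
      by (simp add: power_inverse)
  qed (auto simp: indicator_def)
  then show ?thesis
  proof eventually_elim
    case (elim \<omega>)
    then show ?case
      using kronecker_lemma[of "\<lambda>k. indicator {..t} (y (n + Suc k) \<omega>) - R k \<omega> t"]
      by (simp add: field_simps)
  qed
qed

lemma empirical_cdf_eq:
  "empirical_cdf n y N \<omega> t = (\<Sum>k<N. indicator {..t} (y (n + Suc k) \<omega>)) / real N"
proof -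
  have "(\<Sum>i=1..N. indicator {..t} (y (n + i) \<omega>)) = (\<Sum>k<N. indicator {..t} (y (n + Suc k) \<omega>) :: real)"
    using sum.shift_bounds_Suc_ivl[of "\<lambda>i. indicator {..t} (y (n + i) \<omega>) :: real" 0 N]
    by (simp add: atLeastLessThanSuc_atLeastAtMost lessThan_atLeast0)
  then show ?thesis by (simp add: empirical_cdf_def)
qed

lemma predictive_limit:
  "\<exists>Q \<in> measurable M (prob_algebra borel). \<forall>t. AE \<omega> in M.
     (\<lambda>N. P N \<omega> t) \<longlonglongrightarrow> cdf (Q \<omega>) t \<and>
     convergent (\<lambda>N. empirical_cdf n y N \<omega> t) \<and>
     cdf (Q \<omega>) t = limit_empirical_cdf n y \<omega> t"
proof -
  obtain Q where Q: "Q \<in> measurable M (prob_algebra borel)"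
    and lim: "\<And>t. AE \<omega> in M. (\<lambda>k. R k \<omega> t) \<longlonglongrightarrow> cdf (Q \<omega>) t"
    using random_cdf_limit[OF \<mu>0 R_measurable R_mono R_bounds expectation_R AE_convergent_R] by blast
  have PR: "AE \<omega> in M. \<forall>k. P k \<omega> = R k \<omega>"
    using P_eq_R by (subst AE_all_countable) auto
  have "AE \<omega> in M. (\<lambda>N. P N \<omega> t) \<longlonglongrightarrow> cdf (Q \<omega>) t \<and>
     convergent (\<lambda>N. empirical_cdf n y N \<omega> t) \<and>
     cdf (Q \<omega>) t = limit_empirical_cdf n y \<omega> t" for t
    using lim[of t] PR AE_empirical[of t]
  proof eventually_elim
    case (elim \<omega>)
    \<comment> \<open>The empirical CDF splits into averaged innovations, which vanish, and averaged
      predictive CDFs, which inherit the limit of \<open>R k \<omega> t\<close>.\<close>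
    have "(\<lambda>N. (\<Sum>k<N. indicator {..t} (y (n + Suc k) \<omega>) - R k \<omega> t) / real N + (\<Sum>k<N. R k \<omega> t) / real N)
        \<longlonglongrightarrow> 0 + cdf (Q \<omega>) t"
      by (intro tendsto_add elim cesaro_mean_tendsto)
    then have "(\<lambda>N. empirical_cdf n y N \<omega> t) \<longlonglongrightarrow> cdf (Q \<omega>) t"
      by (simp add: empirical_cdf_eq sum_subtractf diff_divide_distrib)
    with elim show ?case
      by (auto simp: limit_empirical_cdf_def convergent_def limI)
  qed
  with Q show ?thesis by blast
qed

end

theorem proposition3p2:
  fixes M :: "'w measure" and n :: nat and \<rho> \<beta> :: real and \<mu>0 :: "real measure"
    and y :: "nat \<Rightarrow> 'w \<Rightarrow> real" and P :: "nat \<Rightarrow> 'w \<Rightarrow> real \<Rightarrow> real"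
  assumes "prob_space M"
    and "n \<ge> 1" and "0 < \<rho>" and "\<rho> < 1" and "\<beta> > 1/2"
    and "real_distribution \<mu>0" and "absolutely_continuous lborel \<mu>0"
    and "copula_forward_sampling M n \<rho> \<beta> (cdf \<mu>0) y P"
  shows "\<exists>Q \<in> measurable M (prob_algebra borel).
           \<forall>t. AE \<omega> in M.
             (\<lambda>N. P N \<omega> t) \<longlonglongrightarrow> cdf (Q \<omega>) t \<and>
             convergent (\<lambda>N. empirical_cdf n y N \<omega> t) \<and>
             cdf (Q \<omega>) t = limit_empirical_cdf n y \<omega> t"
proof -
  interpret copula_sampling M n \<rho> \<beta> \<mu>0 y P
    using assms by (intro copula_sampling.intro copula_sampling_axioms.intro) auto
  show ?thesis by (rule predictive_limit)
qed

end
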